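(* Let $\lambda>0$ be a real number and let $X=f_1e_1+f_2e_2+f_3e_3$ be a vector field on $(H_3,g_0)$, where $f_1,f_2,f_3$ are smooth real functions of $(x,y,z)\in\mathbb{R}^3$. Then the following are equivalent: (i) $X$ is a curvature collineation; (ii) $X$ is a Ricci collineation; (iii) there exist real constants $c_1,c_2,c_3,c_4$ such that $$\begin{cases} f_1(x,y,z)=-\frac{c_1}{\lambda}x+c_3,\\ f_2(x,y,z)=c_1y+c_2,\\ f_3(x,y,z)=-\frac{c_1\lambda}{2}y^2-\lambda c_2y-\frac{c_1}{2\lambda}x^2+c_3x+c_4.\end{cases}$$
   Context: The Heisenberg group $H_3$ is $\mathbb{R}^3$ with global coordinates $(x,y,z)$ and multiplication $(x,y,z)(\tilde x,\tilde y,\tilde z)=(x+\tilde x,y+\tilde y,z+\tilde z-x\tilde y)$. For $\lambda>0$, $g_0$ is the left-invariant Riemannian metric $g_0=\frac{1}{\lambda^2}dx^2+dy^2+(x\,dy+dz)^2$, with left-invariant orthonormal frame $e_1=\partial_y-x\partial_z$, $e_2=\lambda\partial_x$, $e_3=\partial_z$. The curvature tensor is the $(1,3)$-tensor $R(X,Y)=[\nabla_X,\nabla_Y]-\nabla_{[X,Y]}$ of the Levi-Civita connection $\nabla$, and the Ricci tensor is $\varrho(X,Y)=\sum_k g(e_k,e_k)\,g(R(e_k,X)Y,e_k)$ for an orthonormal basis $\{e_k\}$. A smooth vector field $X$ is a Ricci collineation if $\mathcal{L}_X\varrho=0$ and a curvature collineation if $\mathcal{L}_XR=0$. *)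

theory Defs
  imports "HOL-Analysis.Analysis"
begin

section \<open>Smooth functions and vector fields\<close>

primrec continuously_differentiable ::
  "nat \<Rightarrow> ('a::euclidean_space \<Rightarrow> 'b::real_normed_vector) \<Rightarrow> bool" where
  "continuously_differentiable 0 f \<longleftrightarrow> continuous_on UNIV f"
| "continuously_differentiable (Suc k) f \<longleftrightarrow>
     (\<forall>p. f differentiable (at p)) \<and>
     (\<forall>v. continuously_differentiable k (\<lambda>p. frechet_derivative f (at p) v))"

definition smooth :: "('a::euclidean_space \<Rightarrow> 'b::real_normed_vector) \<Rightarrow> bool" where
  "smooth f \<longleftrightarrow> (\<forall>k. continuously_differentiable k f)"

text \<open>A vector field on a Euclidean space is identified with the function giving
  its components in the global coordinates, e.g. on \<open>real ^ 3\<close> the field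
  \<open>a \<partial>\<^sub>x + b \<partial>\<^sub>y + c \<partial>\<^sub>z\<close> is \<open>\<lambda>p. vector [a p, b p, c p]\<close>.\<close>

type_synonym 'a vfield = "'a \<Rightarrow> 'a"
type_synonym 'a metric = "'a \<Rightarrow> 'a \<Rightarrow> 'a \<Rightarrow> real"
type_synonym 'a connection = "'a vfield \<Rightarrow> 'a vfield \<Rightarrow> 'a vfield"

definition dir_deriv ::
  "'a::euclidean_space vfield \<Rightarrow> ('a \<Rightarrow> 'b::real_normed_vector) \<Rightarrow> 'a \<Rightarrow> 'b" where
  "dir_deriv X f p = frechet_derivative f (at p) (X p)"

text \<open>\<open>[X,Y]\<^sup>i = X(Y\<^sup>i) - Y(X\<^sup>i)\<close> in global coordinates.\<close>

definition lie_bracket :: "'a::euclidean_space vfield \<Rightarrow> 'a vfield \<Rightarrow> 'a vfield" where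
  "lie_bracket X Y = (\<lambda>p. dir_deriv X Y p - dir_deriv Y X p)"


section \<open>Levi-Civita connection, curvature, Ricci tensor\<close>

text \<open>Connections are only constrained on smooth fields; their values on other arguments are
  junk, and every notion below evaluates them on smooth fields only.\<close>

definition affine_connection :: "'a::euclidean_space connection \<Rightarrow> bool" where
  "affine_connection D \<longleftrightarrow>
     (\<forall>X Y. smooth X \<longrightarrow> smooth Y \<longrightarrow> smooth (D X Y)) \<and>
     (\<forall>X X' Y. smooth X \<longrightarrow> smooth X' \<longrightarrow> smooth Y \<longrightarrow>
        D (\<lambda>p. X p + X' p) Y = (\<lambda>p. D X Y p + D X' Y p)) \<and>
     (\<forall>f X Y. smooth f \<longrightarrow> smooth X \<longrightarrow> smooth Y \<longrightarrow>
        D (\<lambda>p. f p *\<^sub>R X p) Y = (\<lambda>p. f p *\<^sub>R D X Y p)) \<and>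
     (\<forall>X Y Y'. smooth X \<longrightarrow> smooth Y \<longrightarrow> smooth Y' \<longrightarrow>
        D X (\<lambda>p. Y p + Y' p) = (\<lambda>p. D X Y p + D X Y' p)) \<and>
     (\<forall>f X Y. smooth f \<longrightarrow> smooth X \<longrightarrow> smooth Y \<longrightarrow>
        D X (\<lambda>p. f p *\<^sub>R Y p) = (\<lambda>p. dir_deriv X f p *\<^sub>R Y p + f p *\<^sub>R D X Y p))"

definition torsion_free :: "'a::euclidean_space connection \<Rightarrow> bool" where
  "torsion_free D \<longleftrightarrow>
     (\<forall>X Y. smooth X \<longrightarrow> smooth Y \<longrightarrow> (\<lambda>p. D X Y p - D Y X p) = lie_bracket X Y)"

definition metric_compatible :: "'a::euclidean_space metric \<Rightarrow> 'a connection \<Rightarrow> bool" where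
  "metric_compatible g D \<longleftrightarrow>
     (\<forall>X Y Z. smooth X \<longrightarrow> smooth Y \<longrightarrow> smooth Z \<longrightarrow>
        (\<forall>p. dir_deriv X (\<lambda>q. g q (Y q) (Z q)) p = g p (D X Y p) (Z p) + g p (Y p) (D X Z p)))"

definition levi_civita_connection :: "'a::euclidean_space metric \<Rightarrow> 'a connection \<Rightarrow> bool" where
  "levi_civita_connection g D \<longleftrightarrow>
     affine_connection D \<and> torsion_free D \<and> metric_compatible g D"

definition curvature ::
  "'a::euclidean_space connection \<Rightarrow> 'a vfield \<Rightarrow> 'a vfield \<Rightarrow> 'a vfield \<Rightarrow> 'a vfield" where
  "curvature D X Y Z = (\<lambda>p. D X (D Y Z) p - D Y (D X Z) p - D (lie_bracket X Y) Z p)"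

text \<open>\<open>E\<close> lists the members of a smooth \<open>g\<close>-orthonormal frame.\<close>

definition ricci ::
  "'a::euclidean_space metric \<Rightarrow> 'a connection \<Rightarrow> 'a vfield list \<Rightarrow> 'a vfield \<Rightarrow> 'a vfield \<Rightarrow> 'a \<Rightarrow> real"
  where
  "ricci g D E X Y p = (\<Sum>e\<leftarrow>E. g p (e p) (e p) * g p (curvature D e X Y p) (e p))"


section \<open>Lie derivatives and collineations\<close>

definition lie_deriv_02 ::
  "'a::euclidean_space vfield \<Rightarrow> ('a vfield \<Rightarrow> 'a vfield \<Rightarrow> 'a \<Rightarrow> real) \<Rightarrow>
   'a vfield \<Rightarrow> 'a vfield \<Rightarrow> 'a \<Rightarrow> real" where
  "lie_deriv_02 X T Y Z p =
     dir_deriv X (T Y Z) p - T (lie_bracket X Y) Z p - T Y (lie_bracket X Z) p"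

definition lie_deriv_13 ::
  "'a::euclidean_space vfield \<Rightarrow> ('a vfield \<Rightarrow> 'a vfield \<Rightarrow> 'a vfield \<Rightarrow> 'a vfield) \<Rightarrow>
   'a vfield \<Rightarrow> 'a vfield \<Rightarrow> 'a vfield \<Rightarrow> 'a vfield" where
  "lie_deriv_13 X T Y Z W = (\<lambda>p.
     lie_bracket X (T Y Z W) p - T (lie_bracket X Y) Z W p - T Y (lie_bracket X Z) W p
       - T Y Z (lie_bracket X W) p)"

definition ricci_collineation ::
  "'a::euclidean_space metric \<Rightarrow> 'a connection \<Rightarrow> 'a vfield list \<Rightarrow> 'a vfield \<Rightarrow> bool" where
  "ricci_collineation g D E X \<longleftrightarrow> smooth X \<and>
     (\<forall>Y Z. smooth Y \<longrightarrow> smooth Z \<longrightarrow> (\<forall>p. lie_deriv_02 X (ricci g D E) Y Z p = 0))"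

definition curvature_collineation :: "'a::euclidean_space connection \<Rightarrow> 'a vfield \<Rightarrow> bool" where
  "curvature_collineation D X \<longleftrightarrow> smooth X \<and>
     (\<forall>Y Z W. smooth Y \<longrightarrow> smooth Z \<longrightarrow> smooth W \<longrightarrow>
        (\<forall>p. lie_deriv_13 X (curvature D) Y Z W p = 0))"


section \<open>The Heisenberg group\<close>

text \<open>\<open>H\<^sub>3\<close> is \<open>real ^ 3\<close> with \<open>(x, y, z) = (p $ 1, p $ 2, p $ 3)\<close>.\<close>

definition heis_mult :: "real ^ 3 \<Rightarrow> real ^ 3 \<Rightarrow> real ^ 3" where
  "heis_mult p q = vector [p $ 1 + q $ 1, p $ 2 + q $ 2, p $ 3 + q $ 3 - p $ 1 * q $ 2]"

definition heis_metric :: "real \<Rightarrow> (real ^ 3) metric" where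
  "heis_metric l p u v =
     1 / l\<^sup>2 * (u $ 1 * v $ 1) + u $ 2 * v $ 2 + (p $ 1 * u $ 2 + u $ 3) * (p $ 1 * v $ 2 + v $ 3)"

definition heis_e1 :: "(real ^ 3) vfield" where
  "heis_e1 p = vector [0, 1, - (p $ 1)]"

definition heis_e2 :: "real \<Rightarrow> (real ^ 3) vfield" where
  "heis_e2 l p = vector [l, 0, 0]"

definition heis_e3 :: "(real ^ 3) vfield" where
  "heis_e3 p = vector [0, 0, 1]"

definition heis_frame :: "real \<Rightarrow> (real ^ 3) vfield list" where
  "heis_frame l = [heis_e1, heis_e2 l, heis_e3]"

lemma heis_frame_orthonormal:
  assumes "l > 0" "i < 3" "j < 3"
  shows "heis_metric l p ((heis_frame l ! i) p) ((heis_frame l ! j) p) = (if i = j then 1 else 0)"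
proof -
  have "i = 0 \<or> i = 1 \<or> i = 2" "j = 0 \<or> j = 1 \<or> j = 2"
    using assms by auto
  then show ?thesis
    using \<open>l > 0\<close>
    by (auto simp: heis_frame_def heis_metric_def heis_e1_def heis_e2_def heis_e3_def
        power2_eq_square)
qed


section \<open>Existence of the Levi-Civita connection of the Heisenberg metric\<close>

lemma continuously_differentiable_lower:
  "continuously_differentiable (Suc k) f \<Longrightarrow> continuously_differentiable k f"
proof (induction k arbitrary: f)
  case 0
  then show ?case
    by (auto intro!: continuous_at_imp_continuous_on differentiable_imp_continuous_within)
next
  case (Suc k)
  then show ?case
    by (metis continuously_differentiable.simps(2))
qed

lemma continuously_differentiable_const: "continuously_differentiable k (\<lambda>p. c)"
proof (induction k arbitrary: c)
  case (Suc k)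
  then show ?case
    by (simp add: frechet_derivative_const)
qed simp

lemma continuously_differentiable_add:
  "continuously_differentiable k f \<Longrightarrow> continuously_differentiable k g \<Longrightarrow>
   continuously_differentiable k (\<lambda>p. f p + g p)"
proof (induction k arbitrary: f g)
  case 0
  then show ?case by (simp add: continuous_on_add)
next
  case (Suc k)
  then have "f differentiable (at p)" "g differentiable (at p)" for p
    by auto
  then have "frechet_derivative (\<lambda>p. f p + g p) (at p) =
      (\<lambda>v. frechet_derivative f (at p) v + frechet_derivative g (at p) v)" for p
    by (intro frechet_derivative_at[symmetric] has_derivative_add)
      (auto simp: frechet_derivative_works)
  with Suc show ?case by simp
qed

lemma continuously_differentiable_linear:
  assumes "bounded_linear T"
  shows "continuously_differentiable k f \<Longrightarrow> continuously_differentiable k (\<lambda>p. T (f p))"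
proof (induction k arbitrary: f)
  case 0
  then show ?case
    using assms by (simp add: bounded_linear.continuous_on)
next
  case (Suc k)
  then have d: "f differentiable (at p)" for p
    by auto
  have h: "((\<lambda>p. T (f p)) has_derivative (\<lambda>v. T (frechet_derivative f (at p) v))) (at p)" for p
    using d[of p] by (intro bounded_linear.has_derivative[OF assms])
      (auto simp: frechet_derivative_works)
  then have "frechet_derivative (\<lambda>p. T (f p)) (at p) = (\<lambda>v. T (frechet_derivative f (at p) v))" for p
    by (intro frechet_derivative_at[symmetric])
  with Suc h show ?case by (auto simp: differentiable_def)
qed

lemma continuously_differentiable_bilinear:
  assumes "bounded_bilinear T"
  shows "continuously_differentiable k f \<Longrightarrow> continuously_differentiable k g \<Longrightarrow>
    continuously_differentiable k (\<lambda>p. T (f p) (g p))"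
proof (induction k arbitrary: f g)
  case 0
  then show ?case
    using assms by (simp add: bounded_bilinear.continuous_on)
next
  case (Suc k)
  then have d: "f differentiable (at p)" "g differentiable (at p)" for p
    by auto
  have h: "((\<lambda>p. T (f p) (g p)) has_derivative
      (\<lambda>v. T (f p) (frechet_derivative g (at p) v) + T (frechet_derivative f (at p) v) (g p))) (at p)"
    for p
    using d[of p] by (intro bounded_bilinear.FDERIV[OF assms])
      (auto simp: frechet_derivative_works)
  then have e: "frechet_derivative (\<lambda>p. T (f p) (g p)) (at p) =
      (\<lambda>v. T (f p) (frechet_derivative g (at p) v) + T (frechet_derivative f (at p) v) (g p))" for p
    by (intro frechet_derivative_at[symmetric])
  have "continuously_differentiable k f" "continuously_differentiable k g"
    using Suc.prems continuously_differentiable_lower by blast+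
  then show ?case
    using h Suc.prems
    by (auto simp: differentiable_def e intro!: continuously_differentiable_add Suc.IH)
qed

lemma smooth_const: "smooth (\<lambda>p. c)"
  by (simp add: smooth_def continuously_differentiable_const)

lemma smooth_add: "smooth f \<Longrightarrow> smooth g \<Longrightarrow> smooth (\<lambda>p. f p + g p)"
  by (simp add: smooth_def continuously_differentiable_add)

lemma smooth_linear: "bounded_linear T \<Longrightarrow> smooth f \<Longrightarrow> smooth (\<lambda>p. T (f p))"
  by (simp add: smooth_def continuously_differentiable_linear)

lemma smooth_scaleR: "smooth f \<Longrightarrow> smooth g \<Longrightarrow> smooth (\<lambda>p. f p *\<^sub>R g p)"
  by (simp add: smooth_def continuously_differentiable_bilinear[OF bounded_bilinear_scaleR])

lemma smooth_mult:
  fixes f g :: "'a::euclidean_space \<Rightarrow> real"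
  shows "smooth f \<Longrightarrow> smooth g \<Longrightarrow> smooth (\<lambda>p. f p * g p)"
  by (simp add: smooth_def continuously_differentiable_bilinear[OF bounded_bilinear_mult])

lemma smooth_id: "smooth (\<lambda>p. p)"
  unfolding smooth_def
proof
  fix k show "continuously_differentiable k (\<lambda>p::'a. p)"
    by (cases k) (auto simp: continuously_differentiable_const)
qed

lemma smooth_component:
  fixes X :: "'a::euclidean_space \<Rightarrow> real ^ 'n"
  shows "smooth X \<Longrightarrow> smooth (\<lambda>p. X p $ i)"
  by (rule smooth_linear[OF bounded_linear_vec_nth])

lemma smooth_frechet_derivative: "smooth f \<Longrightarrow> smooth (\<lambda>p. frechet_derivative f (at p) v)"
  unfolding smooth_def by (metis continuously_differentiable.simps(2))

lemma smooth_has_derivative: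
  assumes "smooth f"
  shows "(f has_derivative frechet_derivative f (at p)) (at p)"
proof -
  have "continuously_differentiable (Suc 0) f"
    using assms by (auto simp: smooth_def)
  then show ?thesis
    by (simp add: frechet_derivative_works)
qed

lemma smooth_dir_deriv:
  fixes X :: "(real ^ 3) vfield"
  assumes "smooth X" "smooth f"
  shows "smooth (dir_deriv X f)"
proof -
  have "dir_deriv X f p = X p $ 1 *\<^sub>R frechet_derivative f (at p) (axis 1 1)
      + X p $ 2 *\<^sub>R frechet_derivative f (at p) (axis 2 1)
      + X p $ 3 *\<^sub>R frechet_derivative f (at p) (axis 3 1)" for p
  proof -
    interpret bounded_linear "frechet_derivative f (at p)"
      using smooth_has_derivative[OF assms(2)] by (rule has_derivative_bounded_linear)
    have "X p = X p $ 1 *\<^sub>R axis 1 1 + X p $ 2 *\<^sub>R axis 2 1 + X p $ 3 *\<^sub>R axis 3 1"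
      by (simp add: vec_eq_iff forall_3 axis_def)
    then show ?thesis
      unfolding dir_deriv_def by (metis add scaleR)
  qed
  then have "dir_deriv X f = (\<lambda>p. X p $ 1 *\<^sub>R frechet_derivative f (at p) (axis 1 1)
      + X p $ 2 *\<^sub>R frechet_derivative f (at p) (axis 2 1)
      + X p $ 3 *\<^sub>R frechet_derivative f (at p) (axis 3 1))"
    by auto
  then show ?thesis
    using assms by (simp add: smooth_add smooth_scaleR smooth_component smooth_frechet_derivative)
qed

lemma dir_deriv_eqI:
  "(f has_derivative f') (at p) \<Longrightarrow> dir_deriv X f p = f' (X p)"
  unfolding dir_deriv_def using frechet_derivative_at by metis

lemma dir_deriv_add:
  "smooth f \<Longrightarrow> smooth g \<Longrightarrow> dir_deriv X (\<lambda>p. f p + g p) p = dir_deriv X f p + dir_deriv X g p"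
  unfolding dir_deriv_def[of X f] dir_deriv_def[of X g]
  by (rule dir_deriv_eqI) (intro has_derivative_add smooth_has_derivative)

lemma dir_deriv_scaleR:
  "smooth f \<Longrightarrow> smooth g \<Longrightarrow>
   dir_deriv X (\<lambda>p. f p *\<^sub>R g p) p = f p *\<^sub>R dir_deriv X g p + dir_deriv X f p *\<^sub>R g p"
  unfolding dir_deriv_def[of X f] dir_deriv_def[of X g]
  by (rule dir_deriv_eqI) (intro has_derivative_scaleR smooth_has_derivative)

lemma dir_deriv_mult:
  fixes f g :: "'a::euclidean_space \<Rightarrow> real"
  shows "smooth f \<Longrightarrow> smooth g \<Longrightarrow>
    dir_deriv X (\<lambda>p. f p * g p) p = f p * dir_deriv X g p + dir_deriv X f p * g p"
  using dir_deriv_scaleR[of f g X p] by simp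

lemma dir_deriv_component:
  fixes Y :: "'a::euclidean_space \<Rightarrow> real ^ 'n"
  shows "smooth Y \<Longrightarrow> dir_deriv X (\<lambda>p. Y p $ i) p = dir_deriv X Y p $ i"
  unfolding dir_deriv_def[of X Y]
  by (rule dir_deriv_eqI) (intro bounded_linear.has_derivative[OF bounded_linear_vec_nth]
      smooth_has_derivative)

lemma dir_deriv_coordinate:
  fixes X :: "(real ^ 'n) vfield"
  shows "dir_deriv X (\<lambda>p. p $ i) p = X p $ i"
  by (rule dir_deriv_eqI) (intro bounded_linear_imp_has_derivative bounded_linear_vec_nth)

lemma dir_deriv_const: "dir_deriv X (\<lambda>p. c) p = 0"
  by (simp add: dir_deriv_def frechet_derivative_const)

text \<open>\<open>D\<^sub>X Y = X(Y) + \<Gamma>(X,Y)\<close> in global coordinates; the witness shows that the hypothesis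
  \<open>levi_civita_connection (heis_metric l) D\<close> is satisfiable.\<close>

definition heis_christoffel :: "real \<Rightarrow> real ^ 3 \<Rightarrow> real ^ 3 \<Rightarrow> real ^ 3 \<Rightarrow> real ^ 3" where
  "heis_christoffel l p u v =
    (- (l\<^sup>2 / 2) * (u $ 2 * (p $ 1 * v $ 2 + v $ 3) + (p $ 1 * u $ 2 + u $ 3) * v $ 2)) *\<^sub>R axis 1 1
    + (1 / 2 * (u $ 1 * (p $ 1 * v $ 2 + v $ 3) + (p $ 1 * u $ 2 + u $ 3) * v $ 1))
        *\<^sub>R (axis 2 1 + (- (p $ 1)) *\<^sub>R axis 3 1)
    + (1 / 2 * (u $ 1 * v $ 2 + u $ 2 * v $ 1)) *\<^sub>R axis 3 1"

definition heis_connection :: "real \<Rightarrow> (real ^ 3) connection" where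
  "heis_connection l X Y = (\<lambda>p. dir_deriv X Y p + heis_christoffel l p (X p) (Y p))"

lemma heis_christoffel_nth:
  "heis_christoffel l p u v $ 1 =
     - (l\<^sup>2 / 2) * (u $ 2 * (p $ 1 * v $ 2 + v $ 3) + (p $ 1 * u $ 2 + u $ 3) * v $ 2)"
  "heis_christoffel l p u v $ 2 =
     1 / 2 * (u $ 1 * (p $ 1 * v $ 2 + v $ 3) + (p $ 1 * u $ 2 + u $ 3) * v $ 1)"
  "heis_christoffel l p u v $ 3 =
     1 / 2 * (u $ 1 * v $ 2 + u $ 2 * v $ 1)
     - p $ 1 * (1 / 2 * (u $ 1 * (p $ 1 * v $ 2 + v $ 3) + (p $ 1 * u $ 2 + u $ 3) * v $ 1))"
  by (simp_all add: heis_christoffel_def axis_def)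

lemma heis_connection_affine: "affine_connection (heis_connection l)"
proof -
  have G: "heis_christoffel l p (u + u') v = heis_christoffel l p u v + heis_christoffel l p u' v"
    "heis_christoffel l p u (v + v') = heis_christoffel l p u v + heis_christoffel l p u v'"
    "heis_christoffel l p (c *\<^sub>R u) v = c *\<^sub>R heis_christoffel l p u v"
    "heis_christoffel l p u (c *\<^sub>R v) = c *\<^sub>R heis_christoffel l p u v" for p u u' v v' c
    by (simp_all add: vec_eq_iff forall_3 heis_christoffel_nth algebra_simps add_divide_distrib)
  have S: "smooth (\<lambda>p. heis_christoffel l p (X p) (Y p))"
    if "smooth X" "smooth Y" for X Y :: "(real ^ 3) vfield"
    unfolding heis_christoffel_def
    using that
    by (intro smooth_add smooth_scaleR smooth_mult smooth_const smooth_component smooth_id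
        smooth_linear[OF bounded_linear_minus[OF bounded_linear_ident]])
  have A: "dir_deriv (\<lambda>p. X p + X' p) Y p = dir_deriv X Y p + dir_deriv X' Y p"
    "dir_deriv (\<lambda>p. f p *\<^sub>R X p) Y p = f p *\<^sub>R dir_deriv X Y p"
    if "smooth Y" for X X' Y :: "(real ^ 3) vfield" and f p
  proof -
    interpret bounded_linear "frechet_derivative Y (at p)"
      using smooth_has_derivative[OF that] by (rule has_derivative_bounded_linear)
    show "dir_deriv (\<lambda>p. X p + X' p) Y p = dir_deriv X Y p + dir_deriv X' Y p"
      "dir_deriv (\<lambda>p. f p *\<^sub>R X p) Y p = f p *\<^sub>R dir_deriv X Y p"
      by (simp_all add: dir_deriv_def add scaleR)
  qed
  show ?thesis
    unfolding affine_connection_def heis_connection_def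
    by (auto simp: G A dir_deriv_add dir_deriv_scaleR fun_eq_iff algebra_simps
        intro!: smooth_add smooth_dir_deriv S)
qed

lemma heis_connection_torsion_free: "torsion_free (heis_connection l)"
proof -
  have "heis_christoffel l p u v = heis_christoffel l p v u" for p u v
    by (simp add: vec_eq_iff forall_3 heis_christoffel_nth algebra_simps)
  then show ?thesis
    by (auto simp: torsion_free_def heis_connection_def lie_bracket_def)
qed

lemma heis_connection_metric:
  assumes "l > 0"
  shows "metric_compatible (heis_metric l) (heis_connection l)"
  unfolding metric_compatible_def
proof (intro allI impI)
  fix X Y Z :: "(real ^ 3) vfield" and p
  assume XYZ: "smooth X" "smooth Y" "smooth Z"
  define c where "c = 1 / l\<^sup>2"
  note s = smooth_add smooth_mult smooth_const smooth_component[OF XYZ(2)]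
    smooth_component[OF XYZ(3)] smooth_component[OF smooth_id]
  have "dir_deriv X (\<lambda>q. heis_metric l q (Y q) (Z q)) p =
      1 / l\<^sup>2 * (Y p $ 1 * dir_deriv X Z p $ 1 + dir_deriv X Y p $ 1 * Z p $ 1)
      + (Y p $ 2 * dir_deriv X Z p $ 2 + dir_deriv X Y p $ 2 * Z p $ 2)
      + ((p $ 1 * Y p $ 2 + Y p $ 3)
          * (p $ 1 * dir_deriv X Z p $ 2 + X p $ 1 * Z p $ 2 + dir_deriv X Z p $ 3)
        + (p $ 1 * dir_deriv X Y p $ 2 + X p $ 1 * Y p $ 2 + dir_deriv X Y p $ 3)
          * (p $ 1 * Z p $ 2 + Z p $ 3))"
    unfolding heis_metric_def c_def[symmetric]
    by (simp add: dir_deriv_add dir_deriv_mult dir_deriv_component dir_deriv_coordinate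
        dir_deriv_const s XYZ)
  also have "\<dots> = heis_metric l p (heis_connection l X Y p) (Z p)
      + heis_metric l p (Y p) (heis_connection l X Z p)"
    using assms
    by (simp add: heis_metric_def heis_connection_def heis_christoffel_nth field_simps
        power2_eq_square)
  finally show "dir_deriv X (\<lambda>q. heis_metric l q (Y q) (Z q)) p = \<dots>" .
qed

theorem heis_levi_civita_connection_exists:
  "l > 0 \<Longrightarrow> levi_civita_connection (heis_metric l) (heis_connection l)"
  by (simp add: levi_civita_connection_def heis_connection_affine heis_connection_torsion_free
      heis_connection_metric)

section \<open>Left invariance\<close>

lemma heis_mult_has_derivative:
  "(heis_mult q has_derivative (\<lambda>v. vector [v $ 1, v $ 2, v $ 3 - q $ 1 * v $ 2])) (at p)"
proof -
  have m: "heis_mult q = (\<lambda>p. q + (p + (- (q $ 1) * p $ 2) *\<^sub>R axis 3 1))"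
    by (auto simp: heis_mult_def fun_eq_iff vec_eq_iff forall_3 axis_def)
  have v: "(vector [v $ 1, v $ 2, v $ 3 - q $ 1 * v $ 2] :: real ^ 3) =
      v + (- (q $ 1) * v $ 2) *\<^sub>R axis 3 1" for v :: "real ^ 3"
    by (auto simp: vec_eq_iff forall_3 axis_def)
  show ?thesis
    unfolding m v by (auto intro!: derivative_eq_intros 
      simp: bounded_linear_vec_nth bounded_linear_imp_has_derivative)
qed

lemma heis_frame_left_invariant:
  assumes "e \<in> set (heis_frame l)"
  shows "frechet_derivative (heis_mult q) (at p) (e p) = e (heis_mult q p)"
  using assms
  by (auto simp: heis_frame_def frechet_derivative_at[OF heis_mult_has_derivative, symmetric]
      heis_e1_def heis_e2_def heis_e3_def heis_mult_def vec_eq_iff forall_3)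

end

(* A Levi-Civita connection is determined on smooth fields, and in the coordinates of the
   left-invariant frame it is X(Y) + G(X,Y) with G constant and bilinear; hence curvature and Ricci
   tensor have constant components.  In the frame, [X,Y] = X(Y) + A(Y) with A linear at each point,
   so a collineation is a field whose A leaves a constant tensor invariant.  For the Ricci tensor,
   whose components are proportional to diag(-1,-1,1), this is skewness of A; contracting shows that
   invariance of the curvature implies it too.  Skewness is a first-order system for f1, f2, f3.  Its
   key consequence is that f1 and f2 do not depend on z: u = d/dz f1 is invariant under
   the flows of d/dx and e1, which together generate translations in z, so u is constant
   in z, and u, d/dz f2 form a harmonic oscillator in z.  Then A is a rotation about e3,
   which preserves the curvature, and the remaining equations integrate to the stated formulas. *)
theory Submission imports Defs
begin

section \<open>Symmetry of second derivatives\<close>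

lemma has_real_derivative_along_line:
  fixes f :: "'a::euclidean_space \<Rightarrow> real"
  assumes "smooth f"
  shows "((\<lambda>t. f (p + t *\<^sub>R w)) has_real_derivative
    frechet_derivative f (at (p + t *\<^sub>R w)) w) (at t)"
proof (rule has_derivative_imp_has_field_derivative)
  have "((\<lambda>t. p + t *\<^sub>R w) has_derivative (\<lambda>h. h *\<^sub>R w)) (at t)"
    by (auto intro!: derivative_eq_intros)
  from has_derivative_compose[OF this smooth_has_derivative[OF assms]]
  show "((\<lambda>t. f (p + t *\<^sub>R w)) has_derivative
      (\<lambda>h. frechet_derivative f (at (p + t *\<^sub>R w)) (h *\<^sub>R w))) (at t)" .
  interpret bounded_linear "frechet_derivative f (at (p + t *\<^sub>R w))"
    using smooth_has_derivative[OF assms] by (rule has_derivative_bounded_linear)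
  show "h * frechet_derivative f (at (p + t *\<^sub>R w)) w =
      frechet_derivative f (at (p + t *\<^sub>R w)) (h *\<^sub>R w)" for h
    by (simp add: scaleR)
qed

text \<open>The mean value theorem is applied twice: first in the direction \<open>u\<close> to the
  difference of \<open>f\<close> along two parallel segments offset by \<open>t *\<^sub>R v\<close>,
  then in the direction \<open>v\<close> to the derivative of \<open>f\<close> along
  \<open>u\<close>.\<close>

lemma second_difference_mean_value:
  fixes f :: "'a::euclidean_space \<Rightarrow> real"
  assumes "smooth f" "t > 0"
  shows "\<exists>r s. 0 < r \<and> r < t \<and> 0 < s \<and> s < t \<and>
    f (p + t *\<^sub>R u + t *\<^sub>R v) - f (p + t *\<^sub>R u) - f (p + t *\<^sub>R v) + f p =
    t\<^sup>2 * frechet_derivative (\<lambda>q. frechet_derivative f (at q) u) (at (p + r *\<^sub>R u + s *\<^sub>R v)) v"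
proof -
  let ?fu = "\<lambda>q. frechet_derivative f (at q) u"
  define h where "h r = f ((p + t *\<^sub>R v) + r *\<^sub>R u) - f (p + r *\<^sub>R u)" for r
  have "(h has_real_derivative (?fu ((p + t *\<^sub>R v) + r *\<^sub>R u) - ?fu (p + r *\<^sub>R u))) (at r)" for r
    unfolding h_def by (intro DERIV_diff has_real_derivative_along_line assms)
  from MVT2[OF \<open>t > 0\<close> this] obtain r where r: "0 < r" "r < t"
    "h t - h 0 = t * (?fu (p + t *\<^sub>R v + r *\<^sub>R u) - ?fu (p + r *\<^sub>R u))"
    by auto
  have "((\<lambda>s. ?fu ((p + r *\<^sub>R u) + s *\<^sub>R v)) has_real_derivative
      frechet_derivative ?fu (at (p + r *\<^sub>R u + s *\<^sub>R v)) v) (at s)" for s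
    by (intro has_real_derivative_along_line smooth_frechet_derivative assms)
  from MVT2[OF \<open>t > 0\<close> this] obtain s where s: "0 < s" "s < t"
    "?fu (p + r *\<^sub>R u + t *\<^sub>R v) - ?fu (p + r *\<^sub>R u + 0 *\<^sub>R v) =
      t * frechet_derivative ?fu (at (p + r *\<^sub>R u + s *\<^sub>R v)) v"
    by auto
  have "f (p + t *\<^sub>R u + t *\<^sub>R v) - f (p + t *\<^sub>R u) - f (p + t *\<^sub>R v) + f p = h t - h 0"
    by (simp add: h_def add.assoc add.commute[of "t *\<^sub>R u"])
  also have "\<dots> = t * (?fu (p + r *\<^sub>R u + t *\<^sub>R v) - ?fu (p + r *\<^sub>R u))"
    using r(3) by (simp add: add.assoc add.commute[of "t *\<^sub>R v"])
  also have "\<dots> = t\<^sup>2 * frechet_derivative ?fu (at (p + r *\<^sub>R u + s *\<^sub>R v)) v"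
    using s(3) by (simp add: power2_eq_square)
  finally show ?thesis
    using r s by blast
qed

lemma smooth_isCont: "smooth f \<Longrightarrow> isCont f p"
  using smooth_has_derivative has_derivative_continuous by blast

text \<open>The intermediate points of the mean value form are chosen as functions of
  \<open>t\<close> lying between 0 and \<open>t\<close>. They are squeezed to 0, and continuity of
  the second derivative gives the limit.\<close>

lemma second_difference_tendsto:
  fixes f :: "'a::euclidean_space \<Rightarrow> real"
  assumes "smooth f"
  shows "((\<lambda>t. (f (p + t *\<^sub>R u + t *\<^sub>R v) - f (p + t *\<^sub>R u) - f (p + t *\<^sub>R v) + f p) / t\<^sup>2) \<longlongrightarrow>
    frechet_derivative (\<lambda>q. frechet_derivative f (at q) u) (at p) v) (at_right 0)"
proof -
  define F where "F q = frechet_derivative (\<lambda>q. frechet_derivative f (at q) u) (at q) v" for q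
  define Q where
    "Q t = (f (p + t *\<^sub>R u + t *\<^sub>R v) - f (p + t *\<^sub>R u) - f (p + t *\<^sub>R v) + f p) / t\<^sup>2" for t
  have "isCont F p"
    unfolding F_def by (intro smooth_isCont smooth_frechet_derivative assms)
  have "\<exists>r s. 0 < r \<and> r < t \<and> 0 < s \<and> s < t \<and> Q t = F (p + r *\<^sub>R u + s *\<^sub>R v)" if "t > 0" for t
  proof -
    have "Q t = x \<longleftrightarrow>
        f (p + t *\<^sub>R u + t *\<^sub>R v) - f (p + t *\<^sub>R u) - f (p + t *\<^sub>R v) + f p = t\<^sup>2 * x" for x
      using that by (auto simp: Q_def divide_eq_eq mult.commute)
    then show ?thesis
      using second_difference_mean_value[OF assms that, of p u v] unfolding F_def by blast
  qed
  then obtain r s where rs: "\<And>t. t > 0 \<Longrightarrow>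
      0 < r t \<and> r t < t \<and> 0 < s t \<and> s t < t \<and> Q t = F (p + r t *\<^sub>R u + s t *\<^sub>R v)"
    by metis
  have pos: "\<forall>\<^sub>F t in at_right 0. (0::real) < t"
    by (rule eventually_at_right_less)
  have id: "((\<lambda>t. t) \<longlongrightarrow> (0::real)) (at_right 0)"
    by (rule tendsto_ident_at)
  have r0: "(r \<longlongrightarrow> 0) (at_right 0)"
    by (rule tendsto_sandwich[OF _ _ tendsto_const id]; rule eventually_mono[OF pos])
      (use rs in \<open>blast intro: less_imp_le\<close>)+
  have s0: "(s \<longlongrightarrow> 0) (at_right 0)"
    by (rule tendsto_sandwich[OF _ _ tendsto_const id]; rule eventually_mono[OF pos])
      (use rs in \<open>blast intro: less_imp_le\<close>)+
  have "((\<lambda>t. p + r t *\<^sub>R u + s t *\<^sub>R v) \<longlongrightarrow> p + 0 *\<^sub>R u + 0 *\<^sub>R v) (at_right 0)"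
    by (intro tendsto_intros r0 s0)
  then have "((\<lambda>t. F (p + r t *\<^sub>R u + s t *\<^sub>R v)) \<longlongrightarrow> F p) (at_right 0)"
    by (intro isCont_tendsto_compose[OF \<open>isCont F p\<close>]) simp
  moreover have "\<forall>\<^sub>F t in at_right 0. F (p + r t *\<^sub>R u + s t *\<^sub>R v) = Q t"
    by (rule eventually_mono[OF pos]) (use rs in metis)
  ultimately have "(Q \<longlongrightarrow> F p) (at_right 0)"
    by (rule Lim_transform_eventually)
  then show ?thesis
    unfolding F_def Q_def .
qed

text \<open>The second difference quotient is symmetric in \<open>u\<close> and \<open>v\<close>, so
  both mixed derivatives are limits of the same function, and limits are unique.\<close>

lemma symmetric_second_derivative:
  fixes f :: "'a::euclidean_space \<Rightarrow> real"
  assumes "smooth f"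
  shows "frechet_derivative (\<lambda>q. frechet_derivative f (at q) u) (at p) v =
    frechet_derivative (\<lambda>q. frechet_derivative f (at q) v) (at p) u"
proof (rule tendsto_unique[OF trivial_limit_at_right_real second_difference_tendsto[OF assms]])
  have swap: "f (p + t *\<^sub>R u + t *\<^sub>R v) - f (p + t *\<^sub>R u) - f (p + t *\<^sub>R v) + f p =
      f (p + t *\<^sub>R v + t *\<^sub>R u) - f (p + t *\<^sub>R v) - f (p + t *\<^sub>R u) + f p" for t
    by (simp add: algebra_simps)
  show "((\<lambda>t. (f (p + t *\<^sub>R u + t *\<^sub>R v) - f (p + t *\<^sub>R u) - f (p + t *\<^sub>R v) + f p) / t\<^sup>2) \<longlongrightarrow>
      frechet_derivative (\<lambda>q. frechet_derivative f (at q) v) (at p) u) (at_right 0)"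
    unfolding swap by (rule second_difference_tendsto[OF assms])
qed

section \<open>Directional derivatives and the bracket as their commutator\<close>

lemma dir_deriv_axis_expansion:
  fixes X :: "(real ^ 3) vfield" and f :: "real ^ 3 \<Rightarrow> real"
  assumes "smooth f"
  shows "dir_deriv X f p = X p $ 1 * frechet_derivative f (at p) (axis 1 1)
      + X p $ 2 * frechet_derivative f (at p) (axis 2 1)
      + X p $ 3 * frechet_derivative f (at p) (axis 3 1)"
proof -
  interpret bounded_linear "frechet_derivative f (at p)"
    using smooth_has_derivative[OF assms] by (rule has_derivative_bounded_linear)
  have "X p = X p $ 1 *\<^sub>R axis 1 1 + X p $ 2 *\<^sub>R axis 2 1 + X p $ 3 *\<^sub>R axis 3 1"
    by (simp add: vec_eq_iff forall_3 axis_def)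
  then have "dir_deriv X f p = frechet_derivative f (at p)
      (X p $ 1 *\<^sub>R axis 1 1 + X p $ 2 *\<^sub>R axis 2 1 + X p $ 3 *\<^sub>R axis 3 1)"
    by (simp add: dir_deriv_def)
  then show ?thesis
    by (simp add: add scaleR)
qed

text \<open>In coordinates the second partials cancel by symmetry. Only the terms in which one field
  differentiates the coefficients of the other survive, and these are the bracket.\<close>

lemma dir_deriv_commutator_real:
  fixes X Y :: "(real ^ 3) vfield" and f :: "real ^ 3 \<Rightarrow> real"
  assumes "smooth X" "smooth Y" "smooth f"
  shows "dir_deriv X (dir_deriv Y f) p - dir_deriv Y (dir_deriv X f) p
    = dir_deriv (lie_bracket X Y) f p"
proof -
  define P where "P i q = frechet_derivative f (at q) (axis i 1)" for i q
  have sP: "smooth (P i)" for i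
    unfolding P_def by (rule smooth_frechet_derivative[OF assms(3)])
  have sym: "frechet_derivative (P i) (at p) (axis j 1) = frechet_derivative (P j) (at p) (axis i 1)"
    for i j
    unfolding P_def by (rule symmetric_second_derivative[OF assms(3)])
  have e: "dir_deriv Z f = (\<lambda>q. Z q $ 1 * P 1 q + Z q $ 2 * P 2 q + Z q $ 3 * P 3 q)" for Z
    by (rule ext) (simp add: P_def dir_deriv_axis_expansion[OF assms(3)])
  have e2: "dir_deriv W (dir_deriv Z f) p =
      dir_deriv W Z p $ 1 * P 1 p + dir_deriv W Z p $ 2 * P 2 p + dir_deriv W Z p $ 3 * P 3 p
      + Z p $ 1 * dir_deriv W (P 1) p + Z p $ 2 * dir_deriv W (P 2) p + Z p $ 3 * dir_deriv W (P 3) p"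
    if "smooth Z" for W Z
    using that unfolding e
    by (simp add: dir_deriv_add dir_deriv_mult dir_deriv_component smooth_add smooth_mult
        smooth_component sP)
  show ?thesis
    unfolding e2[OF assms(1)] e2[OF assms(2)]
    unfolding e dir_deriv_axis_expansion[OF sP] lie_bracket_def
    using sym[of 1 2] sym[of 1 3] sym[of 2 3]
    by (simp add: algebra_simps)
qed

text \<open>The componentwise version for vector-valued functions; it is applied to the frame
  coordinates of a vector field in the curvature computation.\<close>

lemma dir_deriv_commutator:
  fixes X Y :: "(real ^ 3) vfield" and f :: "real ^ 3 \<Rightarrow> real ^ 'n"
  assumes "smooth X" "smooth Y" "smooth f"
  shows "dir_deriv X (dir_deriv Y f) p - dir_deriv Y (dir_deriv X f) p
    = dir_deriv (lie_bracket X Y) f p"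
proof -
  have c: "dir_deriv Z (\<lambda>q. f q $ i) = (\<lambda>q. dir_deriv Z f q $ i)" for Z i
    by (rule ext) (rule dir_deriv_component[OF assms(3)])
  have "(dir_deriv X (dir_deriv Y f) p - dir_deriv Y (dir_deriv X f) p) $ i
      = dir_deriv (lie_bracket X Y) f p $ i" for i
    using dir_deriv_commutator_real[OF assms(1,2) smooth_component[OF assms(3), of i], of p]
    unfolding c by (simp add: dir_deriv_component smooth_dir_deriv assms)
  then show ?thesis
    by (simp add: vec_eq_iff)
qed

section \<open>Uniqueness of the Levi-Civita connection\<close>

lemma levi_civita_connection_unique:
  fixes D D' :: "'a::euclidean_space connection"
  assumes D: "levi_civita_connection g D" and D': "levi_civita_connection g D'"
    and diff: "\<And>p u v w. g p (u - v) w = g p u w - g p v w"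
    and sym: "\<And>p u v. g p u v = g p v u"
    and nondeg: "\<And>p u. (\<And>v. g p u v = 0) \<Longrightarrow> u = 0"
    and "smooth X" "smooth Y"
  shows "D X Y = D' X Y"
proof
  fix p
  define S where "S U V = D U V p - D' U V p" for U V
  have S_sym: "S U V = S V U" if "smooth U" "smooth V" for U V
  proof -
    have "(\<lambda>p. D U V p - D V U p) = lie_bracket U V" "(\<lambda>p. D' U V p - D' V U p) = lie_bracket U V"
      using D D' that by (simp_all add: levi_civita_connection_def torsion_free_def)
    then have "D U V p - D V U p = D' U V p - D' V U p"
      by (auto dest!: fun_cong[of _ _ p])
    then show ?thesis
      by (simp add: S_def algebra_simps)
  qed
  have S_skew: "g p (S U V) (W p) = - g p (S U W) (V p)"
    if "smooth U" "smooth V" "smooth W" for U V W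
  proof -
    have "dir_deriv U (\<lambda>q. g q (V q) (W q)) p = g p (D U V p) (W p) + g p (V p) (D U W p)"
      "dir_deriv U (\<lambda>q. g q (V q) (W q)) p = g p (D' U V p) (W p) + g p (V p) (D' U W p)"
      using D D' that unfolding levi_civita_connection_def metric_compatible_def by blast+
    then show ?thesis
      by (simp add: S_def diff sym[of p "V p"])
  qed
  \<comment> \<open>\<open>g(S(U,V),W)\<close> is symmetric in \<open>U, V\<close> and skew in \<open>V, W\<close>, hence zero.\<close>
  have "g p (S X Y) v = 0" for v
  proof -
    \<comment> \<open>Torsion-freeness and compatibility speak of smooth fields only, so the test
      vector \<open>v\<close> is extended to a constant field.\<close>
    define V where "V = (\<lambda>_::'a. v)"
    have V: "smooth V"
      by (simp add: V_def smooth_const)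
    have "g p (S X Y) (V p) = - g p (S V X) (Y p)"
      using S_skew[of X Y V] S_sym[of X V] V assms by simp
    also have "\<dots> = g p (S Y V) (X p)"
      using S_skew[of V X Y] S_sym[of V Y] V assms by simp
    also have "\<dots> = - g p (S X Y) (V p)"
      using S_skew[of Y V X] S_sym[of X Y] V assms by simp
    finally show ?thesis
      by (simp add: V_def)
  qed
  then show "D X Y p = D' X Y p"
    using nondeg[of p "S X Y"] by (simp add: S_def)
qed

text \<open>Reduces questions about an arbitrary Levi-Civita connection to the explicit
  \<open>heis_connection\<close>. Nondegeneracy of the metric is tested on the coordinate
  axes.\<close>

lemma heis_levi_civita_unique:
  assumes "l > 0" "levi_civita_connection (heis_metric l) D" "smooth X" "smooth Y"
  shows "D X Y = heis_connection l X Y"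
proof (rule levi_civita_connection_unique[OF assms(2) heis_levi_civita_connection_exists[OF assms(1)]
        _ _ _ assms(3,4)])
  fix p u v w :: "real ^ 3"
  show "heis_metric l p (u - v) w = heis_metric l p u w - heis_metric l p v w"
    by (simp add: heis_metric_def diff_divide_distrib algebra_simps)
  show "heis_metric l p u v = heis_metric l p v u"
    by (simp add: heis_metric_def algebra_simps)
next
  fix p u :: "real ^ 3"
  assume *: "\<And>v. heis_metric l p u v = 0"
  show "u = 0"
    using *[of "axis 1 1"] *[of "axis 2 1"] *[of "axis 3 1"] assms(1)
    by (simp add: heis_metric_def axis_def vec_eq_iff forall_3)
qed

lemma smooth_diff: "smooth f \<Longrightarrow> smooth g \<Longrightarrow> smooth (\<lambda>p. f p - g p)"
  using smooth_add[OF _ smooth_linear[OF bounded_linear_minus[OF bounded_linear_ident]], of f g]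
  by simp

lemma smooth_lie_bracket:
  fixes X Y :: "(real ^ 3) vfield"
  assumes "smooth X" "smooth Y"
  shows "smooth (lie_bracket X Y)"
  unfolding lie_bracket_def by (intro smooth_diff smooth_dir_deriv assms)

section \<open>Curvature in the left-invariant frame\<close>

text \<open>These are the components with respect to \<open>heis_e1\<close>,
  \<open>heis_e2 l\<close>, \<open>heis_e3\<close>: the dual coframe is dy, dx / l, x dy +
  dz.\<close>

definition coframe :: "real \<Rightarrow> real ^ 3 \<Rightarrow> real ^ 3 \<Rightarrow> real ^ 3" where
  "coframe l p u = vector [u $ 2, u $ 1 / l, p $ 1 * u $ 2 + u $ 3]"

lemma coframe_nth [simp]:
  "coframe l p u $ 1 = u $ 2" "coframe l p u $ 2 = u $ 1 / l"
  "coframe l p u $ 3 = p $ 1 * u $ 2 + u $ 3"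
  by (simp_all add: coframe_def)

lemma coframe_diff: "coframe l p (u - v) = coframe l p u - coframe l p v"
  by (simp add: vec_eq_iff forall_3 diff_divide_distrib algebra_simps)

lemma coframe_eq_0_iff: "l > 0 \<Longrightarrow> coframe l p u = 0 \<longleftrightarrow> u = 0"
  by (auto simp: vec_eq_iff forall_3)

lemma heis_metric_coframe:
  "heis_metric l p u v = coframe l p u \<bullet> coframe l p v"
  by (simp only: heis_metric_def inner_vec_def sum_3 coframe_nth inner_real_def)
    (simp add: power2_eq_square)

lemma smooth_vec3:
  fixes a b c :: "'a::euclidean_space \<Rightarrow> real"
  assumes "smooth a" "smooth b" "smooth c"
  shows "smooth (\<lambda>p. vector [a p, b p, c p] :: real ^ 3)"
proof -
  have "(\<lambda>p. vector [a p, b p, c p] :: real ^ 3) =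
      (\<lambda>p. a p *\<^sub>R axis 1 1 + b p *\<^sub>R axis 2 1 + c p *\<^sub>R axis 3 1)"
    by (simp add: fun_eq_iff vec_eq_iff forall_3 axis_def)
  then show ?thesis
    using assms by (simp only:) (intro smooth_add smooth_scaleR smooth_const)
qed

lemma smooth_divide_const:
  fixes f :: "'a::euclidean_space \<Rightarrow> real"
  shows "smooth f \<Longrightarrow> smooth (\<lambda>p. f p / c)"
  using smooth_mult[OF _ smooth_const, of f "inverse c"] by (simp add: divide_inverse)

lemma smooth_coframe: "smooth X \<Longrightarrow> smooth (\<lambda>p. coframe l p (X p))"
  unfolding coframe_def
  by (intro smooth_vec3 smooth_add smooth_mult smooth_divide_const smooth_component smooth_id)

lemma dir_deriv_divide_const:
  fixes f :: "'a::euclidean_space \<Rightarrow> real"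
  shows "smooth f \<Longrightarrow> dir_deriv X (\<lambda>p. f p / c) p = dir_deriv X f p / c"
  using dir_deriv_mult[OF _ smooth_const, of f X "inverse c" p]
  by (simp add: divide_inverse dir_deriv_const)

text \<open>The extra term is the derivative of the one non-constant coefficient of the coframe, the
  factor x in x dy + dz.\<close>

lemma dir_deriv_coframe:
  fixes X Y :: "(real ^ 3) vfield"
  assumes "smooth Y"
  shows "dir_deriv X (\<lambda>q. coframe l q (Y q)) p =
    coframe l p (dir_deriv X Y p) + (X p $ 1 * Y p $ 2) *\<^sub>R axis 3 1"
proof -
  have "dir_deriv X (\<lambda>q. coframe l q (Y q)) p $ i = dir_deriv X (\<lambda>q. coframe l q (Y q) $ i) p" for i
    by (rule dir_deriv_component[OF smooth_coframe[OF assms], symmetric])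
  then show ?thesis
    using assms
    by (simp add: vec_eq_iff forall_3 axis_def dir_deriv_component dir_deriv_divide_const
        smooth_component dir_deriv_add dir_deriv_mult smooth_mult smooth_id dir_deriv_coordinate
        algebra_simps)
qed

text \<open>The structure constants of the Heisenberg Lie algebra: up to skew symmetry, [e1, e2] = l
  e3 is the only nonzero bracket of frame fields.\<close>

definition frame_bracket :: "real \<Rightarrow> real ^ 3 \<Rightarrow> real ^ 3 \<Rightarrow> real ^ 3" where
  "frame_bracket l u v = (l * (u $ 1 * v $ 2 - u $ 2 * v $ 1)) *\<^sub>R axis 3 1"

text \<open>The covariant derivative of left-invariant fields in frame components, for example l/2
  e3 for e2 along e1 and -l/2 e2 for e3 along e1.\<close>

definition frame_connection :: "real \<Rightarrow> real ^ 3 \<Rightarrow> real ^ 3 \<Rightarrow> real ^ 3" where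
  "frame_connection l u v = vector
     [l / 2 * (u $ 2 * v $ 3 + u $ 3 * v $ 2),
      - (l / 2) * (u $ 1 * v $ 3 + u $ 3 * v $ 1),
      l / 2 * (u $ 1 * v $ 2 - u $ 2 * v $ 1)]"

text \<open>Diagonal curvature operator with sectional curvatures \<open>-3l\<^sup>2/4\<close> on \<open>e\<^sub>1, e\<^sub>2\<close> and
  \<open>l\<^sup>2/4\<close> on the two other coordinate planes.\<close>

definition frame_curvature :: "real \<Rightarrow> real ^ 3 \<Rightarrow> real ^ 3 \<Rightarrow> real ^ 3 \<Rightarrow> real ^ 3" where
  "frame_curvature l u v w = (let
      m12 = - (3 * l\<^sup>2 / 4) * (u $ 1 * v $ 2 - u $ 2 * v $ 1);
      m13 = l\<^sup>2 / 4 * (u $ 1 * v $ 3 - u $ 3 * v $ 1);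
      m23 = l\<^sup>2 / 4 * (u $ 2 * v $ 3 - u $ 3 * v $ 2)
    in vector [m12 * w $ 2 + m13 * w $ 3, - m12 * w $ 1 + m23 * w $ 3,
      - m13 * w $ 1 - m23 * w $ 2])"

lemma frame_bracket_nth [simp]:
  "frame_bracket l u v $ 1 = 0" "frame_bracket l u v $ 2 = 0"
  "frame_bracket l u v $ 3 = l * (u $ 1 * v $ 2 - u $ 2 * v $ 1)"
  by (simp_all add: frame_bracket_def axis_def)

lemma frame_connection_nth [simp]:
  "frame_connection l u v $ 1 = l / 2 * (u $ 2 * v $ 3 + u $ 3 * v $ 2)"
  "frame_connection l u v $ 2 = - (l / 2) * (u $ 1 * v $ 3 + u $ 3 * v $ 1)"
  "frame_connection l u v $ 3 = l / 2 * (u $ 1 * v $ 2 - u $ 2 * v $ 1)"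
  by (simp_all add: frame_connection_def)

lemma frame_curvature_nth [simp]:
  "frame_curvature l u v w $ 1 = - (3 * l\<^sup>2 / 4) * (u $ 1 * v $ 2 - u $ 2 * v $ 1) * w $ 2
      + l\<^sup>2 / 4 * (u $ 1 * v $ 3 - u $ 3 * v $ 1) * w $ 3"
  "frame_curvature l u v w $ 2 = 3 * l\<^sup>2 / 4 * (u $ 1 * v $ 2 - u $ 2 * v $ 1) * w $ 1
      + l\<^sup>2 / 4 * (u $ 2 * v $ 3 - u $ 3 * v $ 2) * w $ 3"
  "frame_curvature l u v w $ 3 = - (l\<^sup>2 / 4) * (u $ 1 * v $ 3 - u $ 3 * v $ 1) * w $ 1
      - l\<^sup>2 / 4 * (u $ 2 * v $ 3 - u $ 3 * v $ 2) * w $ 2"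
  by (simp_all add: frame_curvature_def Let_def)

text \<open>This is the definition of curvature for left-invariant fields, whose frame components
  have no derivatives. It also writes a trilinear map through bilinear ones, which makes product
  rules available for it.\<close>

lemma frame_curvature_eq:
  "frame_curvature l u v w = frame_connection l u (frame_connection l v w)
    - frame_connection l v (frame_connection l u w) - frame_connection l (frame_bracket l u v) w"
  by (simp add: vec_eq_iff forall_3 power2_eq_square) (simp add: field_simps)

lemma dir_deriv_diff:
  "smooth f \<Longrightarrow> smooth g \<Longrightarrow> dir_deriv X (\<lambda>p. f p - g p) p = dir_deriv X f p - dir_deriv X g p"
  unfolding dir_deriv_def[of X f] dir_deriv_def[of X g]
  by (rule dir_deriv_eqI) (intro has_derivative_diff smooth_has_derivative)

lemma smooth_bilinear:
  "bounded_bilinear T \<Longrightarrow> smooth f \<Longrightarrow> smooth g \<Longrightarrow> smooth (\<lambda>p. T (f p) (g p))"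
  by (simp add: smooth_def continuously_differentiable_bilinear)

lemma dir_deriv_bilinear:
  "bounded_bilinear T \<Longrightarrow> smooth f \<Longrightarrow> smooth g \<Longrightarrow>
   dir_deriv X (\<lambda>p. T (f p) (g p)) p = T (dir_deriv X f p) (g p) + T (f p) (dir_deriv X g p)"
  unfolding dir_deriv_def[of X f] dir_deriv_def[of X g] add.commute[of "T _ (g p)"]
  by (rule dir_deriv_eqI) (intro bounded_bilinear.FDERIV smooth_has_derivative)

lemma bounded_bilinear_frame_bracket: "bounded_bilinear (frame_bracket l)"
  unfolding bilinear_conv_bounded_bilinear[symmetric] bilinear_def
  by (auto intro!: linearI simp: vec_eq_iff forall_3 algebra_simps)

lemma bounded_bilinear_frame_connection: "bounded_bilinear (frame_connection l)"
  unfolding bilinear_conv_bounded_bilinear[symmetric] bilinear_def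
  by (auto intro!: linearI simp: vec_eq_iff forall_3 algebra_simps)

lemmas smooth_frame_bracket = smooth_bilinear[OF bounded_bilinear_frame_bracket]
lemmas smooth_frame_connection = smooth_bilinear[OF bounded_bilinear_frame_connection]
lemmas dir_deriv_frame_bracket = dir_deriv_bilinear[OF bounded_bilinear_frame_bracket]
lemmas dir_deriv_frame_connection = dir_deriv_bilinear[OF bounded_bilinear_frame_connection]
lemmas frame_connection_add_left = bounded_bilinear.add_left[OF bounded_bilinear_frame_connection]
lemmas frame_connection_add_right = bounded_bilinear.add_right[OF bounded_bilinear_frame_connection]
lemmas frame_connection_diff_left = bounded_bilinear.diff_left[OF bounded_bilinear_frame_connection]

section \<open>Covariant derivative, bracket and curvature in frame components\<close>

lemma coframe_heis_connection:
  assumes "l > 0" "smooth Y"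
  shows "coframe l p (heis_connection l X Y p) =
    dir_deriv X (\<lambda>q. coframe l q (Y q)) p + frame_connection l (coframe l p (X p)) (coframe l p (Y p))"
  using assms(1)
  by (simp add: dir_deriv_coframe[OF assms(2)] vec_eq_iff forall_3 axis_def heis_connection_def
      heis_christoffel_nth field_simps power2_eq_square)

text \<open>The correction terms of \<open>dir_deriv_coframe\<close> for the two orders of
  differentiation combine to \<open>frame_bracket\<close>.\<close>

lemma coframe_lie_bracket:
  assumes "l > 0" "smooth X" "smooth Y"
  shows "coframe l p (lie_bracket X Y p) =
    dir_deriv X (\<lambda>q. coframe l q (Y q)) p - dir_deriv Y (\<lambda>q. coframe l q (X q)) p
      + frame_bracket l (coframe l p (X p)) (coframe l p (Y p))"
  using assms(1)
  by (simp add: dir_deriv_coframe[OF assms(2)] dir_deriv_coframe[OF assms(3)] vec_eq_iff forall_3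
      axis_def lie_bracket_def field_simps)

lemma affine_connection_smooth:
  "affine_connection D \<Longrightarrow> smooth X \<Longrightarrow> smooth Y \<Longrightarrow> smooth (D X Y)"
  unfolding affine_connection_def by blast

lemma heis_connection_smooth: "smooth X \<Longrightarrow> smooth Y \<Longrightarrow> smooth (heis_connection l X Y)"
  by (rule affine_connection_smooth[OF heis_connection_affine])

text \<open>As \<open>frame_connection l\<close> is constant and bilinear, the outer derivative of
  the inner zeroth-order term falls on its two arguments only.\<close>

lemma coframe_heis_connection_twice:
  assumes "l > 0" "smooth X" "smooth Y" "smooth Z"
  defines "c \<equiv> \<lambda>U q. coframe l q (U q)"
  shows "coframe l p (heis_connection l X (heis_connection l Y Z) p) =
    dir_deriv X (dir_deriv Y (c Z)) p + frame_connection l (dir_deriv X (c Y) p) (c Z p)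
      + frame_connection l (c Y p) (dir_deriv X (c Z) p)
      + frame_connection l (c X p) (dir_deriv Y (c Z) p)
      + frame_connection l (c X p) (frame_connection l (c Y p) (c Z p))"
proof -
  have sc: "smooth (c Z)" "smooth (c Y)"
    unfolding c_def by (intro smooth_coframe assms)+
  have e: "(\<lambda>q. coframe l q (heis_connection l Y Z q)) =
      (\<lambda>q. dir_deriv Y (c Z) q + frame_connection l (c Y q) (c Z q))"
    by (simp add: c_def coframe_heis_connection assms(1,4))
  have "coframe l p (heis_connection l X (heis_connection l Y Z) p) =
      dir_deriv X (\<lambda>q. dir_deriv Y (c Z) q + frame_connection l (c Y q) (c Z q)) p
      + frame_connection l (c X p) (dir_deriv Y (c Z) p + frame_connection l (c Y p) (c Z p))"
    unfolding e[symmetric] fun_cong[OF e, symmetric]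
    by (simp add: c_def coframe_heis_connection assms(1,3,4) heis_connection_smooth)
  then show ?thesis
    by (simp add: dir_deriv_add dir_deriv_frame_connection frame_connection_add_right sc assms(3)
        smooth_dir_deriv smooth_frame_connection algebra_simps)
qed

text \<open>Second derivatives of the components of \<open>Z\<close> cancel by the commutator
  formula. Terms with first derivatives of \<open>Z\<close> cancel on antisymmetrizing in
  \<open>X\<close> and \<open>Y\<close>, and those with derivatives of \<open>X\<close> and
  \<open>Y\<close> cancel against the bracket term. What remains is
  \<open>frame_curvature_eq\<close>.\<close>

lemma coframe_curvature_heis_connection:
  assumes "l > 0" "smooth X" "smooth Y" "smooth Z"
  shows "coframe l p (curvature (heis_connection l) X Y Z p) =
    frame_curvature l (coframe l p (X p)) (coframe l p (Y p)) (coframe l p (Z p))"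
proof -
  let ?c = "\<lambda>U q. coframe l q (U q)"
  let ?G = "frame_connection l"
  have b: "coframe l p (heis_connection l (lie_bracket X Y) Z p) =
      (dir_deriv X (dir_deriv Y (?c Z)) p - dir_deriv Y (dir_deriv X (?c Z)) p)
      + (?G (dir_deriv X (?c Y) p) (?c Z p) - ?G (dir_deriv Y (?c X) p) (?c Z p)
         + ?G (frame_bracket l (?c X p) (?c Y p)) (?c Z p))"
    by (simp only: coframe_heis_connection[OF assms(1,4)] coframe_lie_bracket[OF assms(1-3)]
        dir_deriv_commutator[OF assms(2,3) smooth_coframe[OF assms(4)]]
        frame_connection_add_left frame_connection_diff_left)
  show ?thesis
    unfolding curvature_def coframe_diff b frame_curvature_eq
      coframe_heis_connection_twice[OF assms] coframe_heis_connection_twice[OF assms(1,3,2,4)]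
    by simp
qed

lemma curvature_levi_civita:
  assumes "l > 0" "levi_civita_connection (heis_metric l) D" "smooth X" "smooth Y" "smooth Z"
  shows "curvature D X Y Z = curvature (heis_connection l) X Y Z"
  unfolding curvature_def
  by (simp add: heis_levi_civita_unique[OF assms(1,2)] assms heis_connection_smooth smooth_lie_bracket)

lemma coframe_curvature:
  assumes "l > 0" "levi_civita_connection (heis_metric l) D" "smooth X" "smooth Y" "smooth Z"
  shows "coframe l p (curvature D X Y Z p) =
    frame_curvature l (coframe l p (X p)) (coframe l p (Y p)) (coframe l p (Z p))"
  using assms by (simp add: curvature_levi_civita coframe_curvature_heis_connection)

lemma smooth_curvature:
  fixes D :: "(real ^ 3) connection"
  assumes "affine_connection D" "smooth X" "smooth Y" "smooth Z"
  shows "smooth (curvature D X Y Z)"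
  unfolding curvature_def
  by (intro smooth_diff affine_connection_smooth[OF assms(1)] smooth_lie_bracket assms(2-4))

lemma smooth_heis_frame:
  "smooth heis_e1" "smooth (heis_e2 l)" "smooth heis_e3"
proof -
  have "smooth (\<lambda>p :: real ^ 3. vector [0, 1, (- 1) * p $ 1] :: real ^ 3)"
    by (intro smooth_vec3 smooth_mult smooth_const smooth_component smooth_id)
  then show "smooth heis_e1"
    by (simp add: heis_e1_def[abs_def])
  show "smooth (heis_e2 l)" "smooth heis_e3"
    by (simp_all add: heis_e2_def[abs_def] heis_e3_def[abs_def] smooth_const)
qed

lemma coframe_heis_frame:
  "l > 0 \<Longrightarrow> coframe l p (a *\<^sub>R heis_e1 p + b *\<^sub>R heis_e2 l p + c *\<^sub>R heis_e3 p) = vector [a, b, c]"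
  by (simp add: vec_eq_iff forall_3 heis_e1_def heis_e2_def heis_e3_def)

section \<open>The Ricci tensor in frame components\<close>

definition frame_ricci :: "real \<Rightarrow> real ^ 3 \<Rightarrow> real ^ 3 \<Rightarrow> real" where
  "frame_ricci l u v = l\<^sup>2 / 2 * (u $ 3 * v $ 3 - u $ 1 * v $ 1 - u $ 2 * v $ 2)"

text \<open>The frame fields have the standard basis vectors as components, so the Ricci sum is the
  trace of \<open>frame_curvature\<close> in its first argument.\<close>

lemma ricci_eq_frame_ricci:
  assumes "l > 0" "levi_civita_connection (heis_metric l) D" "smooth Y" "smooth Z"
  shows "ricci (heis_metric l) D (heis_frame l) Y Z p =
    frame_ricci l (coframe l p (Y p)) (coframe l p (Z p))"
proof -
  have e: "coframe l p (heis_e1 p) = axis 1 1" "coframe l p (heis_e2 l p) = axis 2 1"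
    "coframe l p (heis_e3 p) = axis 3 1"
    using assms(1)
    by (simp_all add: vec_eq_iff forall_3 axis_def heis_e1_def heis_e2_def heis_e3_def)
  show ?thesis
    unfolding ricci_def heis_frame_def heis_metric_coframe
    by (simp add: coframe_curvature[OF assms(1,2) _ assms(3,4)] smooth_heis_frame e inner_axis
        del: coframe_nth)
      (simp add: axis_def frame_ricci_def field_simps del: coframe_nth)
qed

section \<open>Collineations as pointwise invariance\<close>

definition frame :: "real \<Rightarrow> real ^ 3 \<Rightarrow> real ^ 3 \<Rightarrow> real ^ 3" where
  "frame l p u = u $ 1 *\<^sub>R heis_e1 p + u $ 2 *\<^sub>R heis_e2 l p + u $ 3 *\<^sub>R heis_e3 p"

lemma coframe_frame: "l > 0 \<Longrightarrow> coframe l p (frame l p u) = u"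
  by (simp add: frame_def coframe_heis_frame vec_eq_iff forall_3)

lemma frame_coframe: "l > 0 \<Longrightarrow> frame l p (coframe l p u) = u"
  by (simp add: frame_def vec_eq_iff forall_3 heis_e1_def heis_e2_def heis_e3_def)

text \<open>The zeroth-order part of \<open>Y \<mapsto> [X,Y]\<close> in the frame.\<close>

definition bracket_twist :: "real \<Rightarrow> (real ^ 3) vfield \<Rightarrow> real ^ 3 \<Rightarrow> real ^ 3 \<Rightarrow> real ^ 3" where
  "bracket_twist l X p u = frame_bracket l (coframe l p (X p)) u
    - frechet_derivative (\<lambda>q. coframe l q (X q)) (at p) (frame l p u)"

text \<open>The term of the bracket that differentiates \<open>X\<close> along \<open>Y\<close>
  depends on \<open>Y\<close> only through its value at the point, so it joins
  \<open>frame_bracket\<close> in a linear map of the components of \<open>Y\<close>.\<close>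

lemma coframe_lie_bracket_twist:
  assumes "l > 0" "smooth X" "smooth Y"
  shows "coframe l p (lie_bracket X Y p) =
    dir_deriv X (\<lambda>q. coframe l q (Y q)) p + bracket_twist l X p (coframe l p (Y p))"
  unfolding coframe_lie_bracket[OF assms] bracket_twist_def
  by (simp add: dir_deriv_def frame_coframe assms)

lemma linear_bracket_twist:
  assumes "smooth X"
  shows "linear (bracket_twist l X p)"
proof -
  interpret bounded_linear "frechet_derivative (\<lambda>q. coframe l q (X q)) (at p)"
    using smooth_has_derivative[OF smooth_coframe[OF assms]] by (rule has_derivative_bounded_linear)
  have "frame l p (u + v) = frame l p u + frame l p v" "frame l p (c *\<^sub>R u) = c *\<^sub>R frame l p u"
    for u v c
    by (simp_all add: frame_def algebra_simps)
  moreover have "frame_bracket l w (u + v) = frame_bracket l w u + frame_bracket l w v"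
    "frame_bracket l w (c *\<^sub>R u) = c *\<^sub>R frame_bracket l w u" for u v w c
    by (simp_all add: vec_eq_iff forall_3 algebra_simps)
  ultimately show ?thesis
    by (intro linearI) (simp_all add: bracket_twist_def add scaleR algebra_simps)
qed

section \<open>Linear maps that preserve the Ricci form or the curvature infinitesimally\<close>

lemma axis_component: "axis i x $ j = (if i = j then x else 0)"
  by (simp add: axis_def)

lemma linear_vec3_expand:
  fixes A :: "real ^ 3 \<Rightarrow> real ^ 3"
  assumes "linear A"
  shows "A u = u $ 1 *\<^sub>R A (axis 1 1) + u $ 2 *\<^sub>R A (axis 2 1) + u $ 3 *\<^sub>R A (axis 3 1)"
proof -
  have "A u = A (u $ 1 *\<^sub>R axis 1 1 + u $ 2 *\<^sub>R axis 2 1 + u $ 3 *\<^sub>R axis 3 1)"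
    by (rule arg_cong[where f = A]) (simp add: vec_eq_iff forall_3 axis_def)
  then show ?thesis
    using assms by (simp add: linear_add linear_cmul)
qed

text \<open>This is membership in so(2,1), the Lie algebra of the isometry group of diag(-1,-1,1).
  It is written in matrix entries so that each condition turns into one differential
  equation.\<close>

definition skew_for_ricci :: "(real ^ 3 \<Rightarrow> real ^ 3) \<Rightarrow> bool" where
  "skew_for_ricci A \<longleftrightarrow>
    A (axis 1 1) $ 1 = 0 \<and> A (axis 2 1) $ 2 = 0 \<and> A (axis 3 1) $ 3 = 0 \<and>
    A (axis 1 1) $ 2 = - A (axis 2 1) $ 1 \<and>
    A (axis 1 1) $ 3 = A (axis 3 1) $ 1 \<and> A (axis 2 1) $ 3 = A (axis 3 1) $ 2"

lemma frame_ricci_invariant_iff: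
  assumes "l > 0" "linear A"
  shows "(\<forall>u v. frame_ricci l (A u) v + frame_ricci l u (A v) = 0) \<longleftrightarrow> skew_for_ricci A"
proof
  assume *: "\<forall>u v. frame_ricci l (A u) v + frame_ricci l u (A v) = 0"
  \<comment> \<open>The nonzero factor \<open>l\<^sup>2 / 2\<close> is cancelled before testing on
    pairs of axis vectors.\<close>
  have "(A u $ 3 * v $ 3 - A u $ 1 * v $ 1 - A u $ 2 * v $ 2)
      + (u $ 3 * A v $ 3 - u $ 1 * A v $ 1 - u $ 2 * A v $ 2) = 0" for u v
    using *[rule_format, of u v] assms(1)
    unfolding frame_ricci_def distrib_left[symmetric] mult_eq_0_iff by simp
  from this[of "axis 1 1" "axis 1 1"] this[of "axis 2 1" "axis 2 1"] this[of "axis 3 1" "axis 3 1"]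
    this[of "axis 1 1" "axis 2 1"] this[of "axis 1 1" "axis 3 1"] this[of "axis 2 1" "axis 3 1"]
  show "skew_for_ricci A"
    by (simp add: axis_component skew_for_ricci_def)
next
  assume skew: "skew_for_ricci A"
  show "\<forall>u v. frame_ricci l (A u) v + frame_ricci l u (A v) = 0"
  proof (intro allI)
    fix u v
    define a b c where "a = A (axis 1 1)" and "b = A (axis 2 1)" and "c = A (axis 3 1)"
    have "A w = w $ 1 *\<^sub>R a + w $ 2 *\<^sub>R b + w $ 3 *\<^sub>R c" for w
      unfolding a_def b_def c_def by (rule linear_vec3_expand[OF assms(2)])
    then show "frame_ricci l (A u) v + frame_ricci l u (A v) = 0"
      using skew unfolding skew_for_ricci_def a_def[symmetric] b_def[symmetric] c_def[symmetric]
      by (simp add: frame_ricci_def algebra_simps)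
  qed
qed

text \<open>Contraction commutes with the infinitesimal action of \<open>A\<close>, so invariance of
  the curvature passes to its trace, the Ricci form.\<close>

lemma skew_for_ricci_if_curvature_invariant:
  assumes "l > 0" and "linear A"
    and *: "\<And>u v w. A (frame_curvature l u v w) - frame_curvature l (A u) v w
      - frame_curvature l u (A v) w - frame_curvature l u v (A w) = 0"
  shows "skew_for_ricci A"
proof -
  have t: "frame_ricci l v w = (\<Sum>k\<in>UNIV. frame_curvature l (axis k 1) v w $ k)" for v w
    by (simp add: sum_3 axis_def frame_ricci_def field_simps)
  \<comment> \<open>With M the endomorphism \<open>\<lambda>u. frame_curvature l u v w\<close>, this
    says that A M and M A have the same trace. Hence the first two terms of the contracted identity
    cancel.\<close>
  have c: "(\<Sum>k\<in>UNIV. A (frame_curvature l (axis k 1) v w) $ k) =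
      (\<Sum>k\<in>UNIV. frame_curvature l (A (axis k 1)) v w $ k)" for v w
    unfolding linear_vec3_expand[OF assms(2), of "frame_curvature l _ v w"]
    by (simp add: sum_3 axis_def algebra_simps)
  have "frame_ricci l (A v) w + frame_ricci l v (A w) = 0" for v w
  proof -
    have "(\<Sum>k\<in>UNIV. (A (frame_curvature l (axis k 1) v w) - frame_curvature l (A (axis k 1)) v w
      - frame_curvature l (axis k 1) (A v) w - frame_curvature l (axis k 1) v (A w)) $ k) = 0"
      by (simp only: * zero_index sum.neutral_const)
    then show ?thesis
      unfolding t using c[of v w] by (simp only: vector_minus_component sum_subtractf)
  qed
  then show ?thesis
    using frame_ricci_invariant_iff[OF assms(1,2)] by blast
qed

text \<open>Once \<open>A\<close> kills e3, skewness leaves only multiples of the rotation generator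
  in the plane of e1 and e2, and \<open>frame_curvature\<close> is symmetric under these
  rotations.\<close>

lemma curvature_invariant_if_rotation:
  assumes "linear A" "skew_for_ricci A" "A (axis 3 1) = 0"
  shows "A (frame_curvature l u v w) - frame_curvature l (A u) v w
      - frame_curvature l u (A v) w - frame_curvature l u v (A w) = 0"
proof -
  define a where "a = A (axis 2 1) $ 1"
  have "A u $ 1 = a * u $ 2" "A u $ 2 = - a * u $ 1" "A u $ 3 = 0" for u
    using assms(2,3) linear_vec3_expand[OF assms(1), of u] by (simp_all add: skew_for_ricci_def a_def)
  then show ?thesis
    by (simp add: vec_eq_iff forall_3 algebra_simps)
qed

section \<open>Lie derivatives of the Ricci and curvature tensors\<close>

lemma bounded_bilinear_frame_ricci: "bounded_bilinear (frame_ricci l)"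
  unfolding bilinear_conv_bounded_bilinear[symmetric] bilinear_def
  by (auto intro!: linearI simp: frame_ricci_def field_simps)

text \<open>The components of the tensor are constant, so the derivatives of \<open>Y\<close> and
  \<open>Z\<close> along \<open>X\<close> cancel in the Lie derivative and only the action of
  \<open>bracket_twist\<close> is left.\<close>

lemma ricci_collineation_iff:
  assumes "l > 0" "levi_civita_connection (heis_metric l) D" "smooth X"
  shows "ricci_collineation (heis_metric l) D (heis_frame l) X \<longleftrightarrow>
    (\<forall>p. skew_for_ricci (bracket_twist l X p))"
proof -
  let ?c = "\<lambda>Y p. coframe l p (Y p)"
  have lie: "lie_deriv_02 X (ricci (heis_metric l) D (heis_frame l)) Y Z p =
      - (frame_ricci l (bracket_twist l X p (?c Y p)) (?c Z p)
         + frame_ricci l (?c Y p) (bracket_twist l X p (?c Z p)))"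
    if YZ: "smooth Y" "smooth Z" for Y Z p
  proof -
    have e: "ricci (heis_metric l) D (heis_frame l) Y Z = (\<lambda>p. frame_ricci l (?c Y p) (?c Z p))"
      by (simp add: fun_eq_iff ricci_eq_frame_ricci assms YZ)
    have "dir_deriv X (ricci (heis_metric l) D (heis_frame l) Y Z) p =
        frame_ricci l (dir_deriv X (?c Y) p) (?c Z p) + frame_ricci l (?c Y p) (dir_deriv X (?c Z) p)"
      unfolding e by (intro dir_deriv_bilinear bounded_bilinear_frame_ricci smooth_coframe YZ)
    then show ?thesis
      unfolding lie_deriv_02_def
      by (simp add: ricci_eq_frame_ricci assms YZ smooth_lie_bracket coframe_lie_bracket_twist
          del: coframe_nth)
        (simp add: frame_ricci_def algebra_simps del: coframe_nth)
  qed
  have "(\<forall>Y Z. smooth Y \<longrightarrow> smooth Z \<longrightarrow>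
        (\<forall>p. lie_deriv_02 X (ricci (heis_metric l) D (heis_frame l)) Y Z p = 0)) \<longleftrightarrow>
      (\<forall>p u v. frame_ricci l (bracket_twist l X p u) v + frame_ricci l u (bracket_twist l X p v) = 0)"
    (is "?L \<longleftrightarrow> ?R")
  proof
    assume ?L
    \<comment> \<open>Constant coordinate fields with values \<open>frame l p u\<close> and
      \<open>frame l p v\<close> realize arbitrary frame components at \<open>p\<close>.\<close>
    then have "frame_ricci l (bracket_twist l X p (coframe l p (frame l p u))) (coframe l p (frame l p v))
        + frame_ricci l (coframe l p (frame l p u)) (bracket_twist l X p (coframe l p (frame l p v))) = 0"
      for p u v
      using lie[of "\<lambda>_. frame l p u" "\<lambda>_. frame l p v" p] by (simp add: smooth_const del: coframe_nth)
    then show ?R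
      by (simp add: coframe_frame assms)
  qed (simp add: lie)
  then show ?thesis
    using frame_ricci_invariant_iff[OF assms(1) linear_bracket_twist[OF assms(3)]] assms(3)
    by (simp add: ricci_collineation_def)
qed

lemma dir_deriv_frame_curvature:
  fixes X :: "(real ^ 3) vfield" and U V W :: "real ^ 3 \<Rightarrow> real ^ 3"
  assumes "smooth U" "smooth V" "smooth W"
  shows "dir_deriv X (\<lambda>p. frame_curvature l (U p) (V p) (W p)) p =
    frame_curvature l (dir_deriv X U p) (V p) (W p) + frame_curvature l (U p) (dir_deriv X V p) (W p)
    + frame_curvature l (U p) (V p) (dir_deriv X W p)"
  unfolding frame_curvature_eq
  by (simp add: dir_deriv_diff dir_deriv_frame_connection dir_deriv_frame_bracket
      smooth_frame_bracket smooth_frame_connection smooth_diff assms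
      frame_connection_add_left frame_connection_add_right)

text \<open>The argument is that for the Ricci tensor, with the trilinear product rule. Because the
  result is a vector field, \<open>A\<close> also acts on the value of the tensor.\<close>

lemma curvature_collineation_iff:
  assumes "l > 0" "levi_civita_connection (heis_metric l) D" "smooth X"
  defines "A \<equiv> bracket_twist l X"
  shows "curvature_collineation D X \<longleftrightarrow>
    (\<forall>p u v w. A p (frame_curvature l u v w) - frame_curvature l (A p u) v w
      - frame_curvature l u (A p v) w - frame_curvature l u v (A p w) = 0)"
proof -
  let ?c = "\<lambda>Y p. coframe l p (Y p)"
  have "affine_connection D"
    using assms(2) by (simp add: levi_civita_connection_def)
  have add: "frame_curvature l (u + u') v w = frame_curvature l u v w + frame_curvature l u' v w"
    "frame_curvature l u (v + v') w = frame_curvature l u v w + frame_curvature l u v' w"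
    "frame_curvature l u v (w + w') = frame_curvature l u v w + frame_curvature l u v w'"
    for u u' v v' w w'
    by (simp_all add: vec_eq_iff forall_3) (simp_all add: field_simps)
  have lie: "coframe l p (lie_deriv_13 X (curvature D) Y Z W p) =
      A p (frame_curvature l (?c Y p) (?c Z p) (?c W p)) - frame_curvature l (A p (?c Y p)) (?c Z p) (?c W p)
      - frame_curvature l (?c Y p) (A p (?c Z p)) (?c W p)
      - frame_curvature l (?c Y p) (?c Z p) (A p (?c W p))"
    if s: "smooth Y" "smooth Z" "smooth W" for Y Z W p
  proof -
    have e: "?c (curvature D Y Z W) = (\<lambda>p. frame_curvature l (?c Y p) (?c Z p) (?c W p))"
      by (simp add: fun_eq_iff coframe_curvature assms s)
    have "coframe l p (lie_bracket X (curvature D Y Z W) p) =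
        dir_deriv X (\<lambda>p. frame_curvature l (?c Y p) (?c Z p) (?c W p)) p
        + A p (frame_curvature l (?c Y p) (?c Z p) (?c W p))"
      using coframe_lie_bracket_twist[OF assms(1,3)
          smooth_curvature[OF \<open>affine_connection D\<close> s], of p]
      unfolding A_def e fun_cong[OF e] .
    then show ?thesis
      unfolding lie_deriv_13_def coframe_diff
      by (simp add: coframe_curvature[OF assms(1,2)] s smooth_lie_bracket assms(1,3)
          coframe_lie_bracket_twist A_def[symmetric] dir_deriv_frame_curvature smooth_coframe add)
  qed
  have "(\<forall>Y Z W. smooth Y \<longrightarrow> smooth Z \<longrightarrow> smooth W \<longrightarrow>
        (\<forall>p. lie_deriv_13 X (curvature D) Y Z W p = 0)) \<longleftrightarrow>
    (\<forall>p u v w. A p (frame_curvature l u v w) - frame_curvature l (A p u) v w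
      - frame_curvature l u (A p v) w - frame_curvature l u v (A p w) = 0)"
    (is "?L \<longleftrightarrow> ?R")
  proof
    assume L: ?L
    show ?R
    proof (intro allI)
      fix p u v w
      have "coframe l p (lie_deriv_13 X (curvature D) (\<lambda>_. frame l p u) (\<lambda>_. frame l p v)
          (\<lambda>_. frame l p w) p) = 0"
        using L assms(1) by (simp add: smooth_const coframe_eq_0_iff)
      then show "A p (frame_curvature l u v w) - frame_curvature l (A p u) v w
          - frame_curvature l u (A p v) w - frame_curvature l u v (A p w) = 0"
        by (simp add: lie smooth_const coframe_frame assms(1))
    qed
  next
    assume ?R
    then have "coframe l p (lie_deriv_13 X (curvature D) Y Z W p) = 0"
      if "smooth Y" "smooth Z" "smooth W" for Y Z W p
      unfolding lie[OF that] by blast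
    then show ?L
      by (simp add: coframe_eq_0_iff assms(1))
  qed
  then show ?thesis
    using assms(3) by (simp add: curvature_collineation_def)
qed

section \<open>The differential equations\<close>

abbreviation partial :: "3 \<Rightarrow> (real ^ 3 \<Rightarrow> real) \<Rightarrow> real ^ 3 \<Rightarrow> real" where
  "partial i f p \<equiv> frechet_derivative f (at p) (axis i 1)"

text \<open>The conditions of \<open>skew_for_ricci\<close> for \<open>bracket_twist\<close>, in the
  same order and in coordinates: e1 acts as d/dy - x d/dz, e2 as l d/dx, e3 as d/dz. The third
  equation has been substituted into the fifth.\<close>

definition collineation_system ::
  "real \<Rightarrow> (real ^ 3 \<Rightarrow> real) \<Rightarrow> (real ^ 3 \<Rightarrow> real) \<Rightarrow> (real ^ 3 \<Rightarrow> real) \<Rightarrow> bool" where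
  "collineation_system l f1 f2 f3 \<longleftrightarrow> (\<forall>p.
     partial 2 f1 p = p $ 1 * partial 3 f1 p \<and> partial 1 f2 p = 0 \<and> partial 3 f3 p = 0 \<and>
     partial 2 f2 p - p $ 1 * partial 3 f2 p = - l * partial 1 f1 p \<and>
     l * f2 p + partial 2 f3 p = partial 3 f1 p \<and>
     l * partial 1 f3 p - l * f1 p = partial 3 f2 p)"

lemma bracket_twist_nth:
  assumes "l > 0" "smooth f1" "smooth f2" "smooth f3"
    and X: "X = (\<lambda>p. f1 p *\<^sub>R heis_e1 p + f2 p *\<^sub>R heis_e2 l p + f3 p *\<^sub>R heis_e3 p)"
  shows "bracket_twist l X p u $ 1 = - frechet_derivative f1 (at p) (frame l p u)"
    "bracket_twist l X p u $ 2 = - frechet_derivative f2 (at p) (frame l p u)"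
    "bracket_twist l X p u $ 3 =
      l * (f1 p * u $ 2 - f2 p * u $ 1) - frechet_derivative f3 (at p) (frame l p u)"
proof -
  have c: "(\<lambda>q. coframe l q (X q)) = (\<lambda>q. vector [f1 q, f2 q, f3 q])"
    using assms(1) by (simp add: X coframe_heis_frame)
  have sm: "smooth (\<lambda>q. vector [f1 q, f2 q, f3 q] :: real ^ 3)"
    by (intro smooth_vec3 assms)
  have D: "frechet_derivative (\<lambda>q. vector [f1 q, f2 q, f3 q] :: real ^ 3) (at p) v $ i =
      frechet_derivative (\<lambda>q. (vector [f1 q, f2 q, f3 q] :: real ^ 3) $ i) (at p) v" for p v i
    using dir_deriv_component[OF sm, of "\<lambda>_. v" i p] by (simp add: dir_deriv_def)
  show "bracket_twist l X p u $ 1 = - frechet_derivative f1 (at p) (frame l p u)"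
    "bracket_twist l X p u $ 2 = - frechet_derivative f2 (at p) (frame l p u)"
    "bracket_twist l X p u $ 3 =
      l * (f1 p * u $ 2 - f2 p * u $ 1) - frechet_derivative f3 (at p) (frame l p u)"
    unfolding bracket_twist_def c fun_cong[OF c] vector_minus_component D by simp_all
qed

lemma frame_axis:
  "frame l p (axis 1 1) = axis 2 1 - p $ 1 *\<^sub>R axis 3 1"
  "frame l p (axis 2 1) = l *\<^sub>R axis 1 1" "frame l p (axis 3 1) = axis 3 1"
  by (simp_all add: vec_eq_iff forall_3 frame_def axis_def heis_e1_def heis_e2_def heis_e3_def)

lemma skew_bracket_twist_iff:
  assumes "l > 0" "smooth f1" "smooth f2" "smooth f3"
    and X: "X = (\<lambda>p. f1 p *\<^sub>R heis_e1 p + f2 p *\<^sub>R heis_e2 l p + f3 p *\<^sub>R heis_e3 p)"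
  shows "(\<forall>p. skew_for_ricci (bracket_twist l X p)) \<longleftrightarrow> collineation_system l f1 f2 f3"
proof -
  have lin: "linear (frechet_derivative f (at p))" if "smooth f" for f :: "real ^ 3 \<Rightarrow> real" and p
    using smooth_has_derivative[OF that] by (rule has_derivative_linear)
  show ?thesis
    using \<open>l > 0\<close>
    unfolding collineation_system_def skew_for_ricci_def bracket_twist_nth[OF assms] frame_axis
    by (intro all_cong1) (auto simp: axis_component linear_diff linear_cmul lin assms(2-4) algebra_simps)
qed

section \<open>Functions with prescribed derivatives along lines\<close>

lemma constant_along_line:
  fixes f :: "'a::euclidean_space \<Rightarrow> real"
  assumes "smooth f" "\<And>t. frechet_derivative f (at (p + t *\<^sub>R w)) w = 0"
  shows "f (p + t *\<^sub>R w) = f p"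
proof -
  have "((\<lambda>t. f (p + t *\<^sub>R w)) has_real_derivative 0) (at t)" for t
    using has_real_derivative_along_line[OF assms(1), of p w t] by (simp add: assms(2))
  from DERIV_isconst_all[of "\<lambda>t. f (p + t *\<^sub>R w)" t 0] this show ?thesis
    by simp
qed

lemma frechet_derivative_eq_if_eq_along_lines:
  fixes f :: "'a::euclidean_space \<Rightarrow> real"
  assumes "smooth f" "\<And>s. f (p + s *\<^sub>R w) = f (q + s *\<^sub>R w)"
  shows "frechet_derivative f (at p) w = frechet_derivative f (at q) w"
  using DERIV_unique has_real_derivative_along_line[OF assms(1), of p w 0]
    has_real_derivative_along_line[OF assms(1), of q w 0]
  by (simp add: assms(2))

lemma frechet_derivative_translate:
  fixes f :: "'a::euclidean_space \<Rightarrow> real"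
  assumes "smooth f" "\<And>q. f (q + a) = f q"
  shows "frechet_derivative f (at (p + a)) w = frechet_derivative f (at p) w"
proof (rule frechet_derivative_eq_if_eq_along_lines[OF assms(1)])
  show "f (p + a + s *\<^sub>R w) = f (p + s *\<^sub>R w)" for s
    using assms(2)[of "p + s *\<^sub>R w"] by (simp add: algebra_simps)
qed

lemma eq_plus_const_if_derivative_eq:
  fixes f F :: "'a::euclidean_space \<Rightarrow> real"
  assumes "smooth f" "\<And>p. (F has_derivative F' p) (at p)"
    and "\<And>p v. frechet_derivative f (at p) v = F' p v"
  shows "\<exists>c. \<forall>p. f p = F p + c"
proof -
  have "((\<lambda>p. f p - F p) has_derivative (\<lambda>v. 0)) (at p)" for p
    using has_derivative_diff[OF smooth_has_derivative[OF assms(1), of p] assms(2)[of p]]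
    by (simp add: assms(3))
  then have "\<exists>c. \<forall>p\<in>UNIV. f p - F p = c"
    by (intro has_derivative_zero_constant) auto
  then show ?thesis
    by (auto simp: algebra_simps)
qed

lemma frechet_derivative_partials:
  assumes "smooth f"
  shows "frechet_derivative f (at p) v = v $ 1 * partial 1 f p + v $ 2 * partial 2 f p + v $ 3 * partial 3 f p"
  using dir_deriv_axis_expansion[OF assms, of "\<lambda>_. v" p] by (simp add: dir_deriv_def)

lemma has_derivative_vec_nth: "((\<lambda>p :: real ^ 'n. p $ i) has_derivative (\<lambda>v. v $ i)) (at p)"
  by (intro bounded_linear_imp_has_derivative bounded_linear_vec_nth)

text \<open>Because \<open>f3\<close> and its partials are constant in z, differentiating the last
  two equations in z gives u_z = l v and v_z = - l u. Invariance of \<open>u\<close> in z then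
  forces \<open>v = 0\<close>, and therefore \<open>u = 0\<close>.\<close>

lemma collineation_system_vertical_derivatives:
  assumes "l > 0" and sm: "smooth f1" "smooth f2" "smooth f3"
    and sys: "collineation_system l f1 f2 f3"
  shows "partial 3 f1 p = 0" "partial 3 f2 p = 0"
proof -
  define u where "u = partial 3 f1"
  define v where "v = partial 3 f2"
  have su: "smooth u" and sv: "smooth v"
    unfolding u_def v_def by (intro smooth_frechet_derivative sm)+
  have eq1: "partial 2 f1 p = p $ 1 * partial 3 f1 p" and eq2: "partial 1 f2 p = 0"
    and eq3: "partial 3 f3 p = 0" and eq5: "u p = l * f2 p + partial 2 f3 p"
    and eq6: "v p = l * partial 1 f3 p - l * f1 p" for p
    using sys by (simp_all add: collineation_system_def u_def v_def)
  have f2_x: "f2 (p + t *\<^sub>R axis 1 1) = f2 p" for p t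
    by (rule constant_along_line[OF sm(2)]) (rule eq2)
  have f3_z: "f3 (p + t *\<^sub>R axis 3 1) = f3 p" for p t
    by (rule constant_along_line[OF sm(3)]) (rule eq3)
  have v_x: "v (p + t *\<^sub>R axis 1 1) = v p" for p t
    unfolding v_def by (rule frechet_derivative_translate[OF sm(2) f2_x])
  have dv_x: "partial 3 v (p + t *\<^sub>R axis 1 1) = partial 3 v p" for p t
    by (rule frechet_derivative_translate[OF sv v_x])
  have f3_xy: "partial i f3 (p + t *\<^sub>R axis 3 1) = partial i f3 p" for i p t
    by (rule frechet_derivative_translate[OF sm(3) f3_z])
  have d0: "((\<lambda>t. partial i f3 (p + t *\<^sub>R axis 3 1)) has_real_derivative 0) (at t)" for i p t
    by (simp add: f3_xy)
  have du: "partial 3 u p = l * v p" for p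
  proof -
    have "((\<lambda>t. u (p + t *\<^sub>R axis 3 1)) has_real_derivative l * v (p + 0 *\<^sub>R axis 3 1) + 0) (at 0)"
      unfolding eq5 unfolding v_def
      by (intro DERIV_add DERIV_cmult has_real_derivative_along_line sm d0)
    with has_real_derivative_along_line[OF su, of p "axis 3 1" 0] show ?thesis
      using DERIV_unique by fastforce
  qed
  have dv: "partial 3 v p = - l * u p" for p
  proof -
    have "((\<lambda>t. v (p + t *\<^sub>R axis 3 1)) has_real_derivative
        l * 0 - l * u (p + 0 *\<^sub>R axis 3 1)) (at 0)"
      unfolding eq6 unfolding u_def
      by (intro DERIV_diff DERIV_cmult has_real_derivative_along_line sm d0)
    with has_real_derivative_along_line[OF sv, of p "axis 3 1" 0] show ?thesis
      using DERIV_unique by fastforce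
  qed
  \<comment> \<open>Independence of x passes from \<open>f2\<close> to its z-derivative
    \<open>v\<close>, then to the z-derivative of \<open>v\<close>, which is - l u.\<close>
  have u_x: "u (p + t *\<^sub>R axis 1 1) = u p" for p t
    using dv_x[of p t] \<open>l > 0\<close> by (simp add: dv)
  \<comment> \<open>The line through \<open>p\<close> in the direction of e1 at \<open>p\<close> is
    an integral curve of e1, since x stays constant on it; the first equation says that e1
    annihilates \<open>f1\<close>.\<close>
  have f1_e1: "f1 (p + t *\<^sub>R (axis 2 1 - p $ 1 *\<^sub>R axis 3 1)) = f1 p" for p t
  proof (rule constant_along_line[OF sm(1)])
    show "frechet_derivative f1 (at (p + s *\<^sub>R (axis 2 1 - p $ 1 *\<^sub>R axis 3 1)))
        (axis 2 1 - p $ 1 *\<^sub>R axis 3 1) = 0" for s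
      by (simp add: frechet_derivative_partials[OF sm(1), of _ "axis 2 1 - p $ 1 *\<^sub>R axis 3 1"]
          axis_component eq1)
  qed
  \<comment> \<open>Moving in z leaves the direction of e1 unchanged, so \<open>f1\<close> agrees on
    the two vertical lines, and so does its z-derivative.\<close>
  have u_e1: "u (p + t *\<^sub>R (axis 2 1 - p $ 1 *\<^sub>R axis 3 1)) = u p" for p t
    unfolding u_def
  proof (rule frechet_derivative_eq_if_eq_along_lines[OF sm(1)])
    show "f1 (p + t *\<^sub>R (axis 2 1 - p $ 1 *\<^sub>R axis 3 1) + s *\<^sub>R axis 3 1) = f1 (p + s *\<^sub>R axis 3 1)"
      for s
      using f1_e1[of "p + s *\<^sub>R axis 3 1" t] by (simp add: axis_component algebra_simps)
  qed
  \<comment> \<open>The flows of \<open>e\<^sub>1\<close> and \<open>\<partial>\<^sub>x\<close> preserve \<open>u\<close>; going around a rectangle moves along \<open>\<partial>\<^sub>z\<close>.\<close>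
  have u_z: "u (vector [x, y, z + s]) = u (vector [x, y, z])" for x y z s
  proof -
    have mv_x: "u (vector [a, y, z]) = u (vector [b, y, z])" for a b y z
      using u_x[of "vector [b, y, z]" "a - b"]
      by (rule back_subst[where P = "\<lambda>q. u q = _"]) (simp add: vec_eq_iff forall_3 axis_def)
    have mv_e1: "u (vector [a, y + t, z - a * t]) = u (vector [a, y, z])" for a y z t
      using u_e1[of "vector [a, y, z]" t]
      by (rule back_subst[where P = "\<lambda>q. u q = _"]) (simp add: vec_eq_iff forall_3 axis_def)
    have "u (vector [x, y, z]) = u (vector [0, y + 1, z])"
      using mv_x[of x y z 0] mv_e1[of 0 y 1 z] by simp
    also have "\<dots> = u (vector [s, y, z + s])"
      using mv_x[of 0 "y + 1" z s] mv_e1[of s y 1 "z + s"] by simp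
    finally show ?thesis
      using mv_x[of s y "z + s" x] by simp
  qed
  have "partial 3 u p = 0" for p
  proof -
    have "u (p + t *\<^sub>R axis 3 1) = u p" for t
    proof -
      have "p + t *\<^sub>R axis 3 1 = vector [p $ 1, p $ 2, p $ 3 + t]"
        "p = vector [p $ 1, p $ 2, p $ 3]"
        by (simp_all add: vec_eq_iff forall_3 axis_def)
      then show ?thesis
        using u_z by metis
    qed
    then have "((\<lambda>t. u (p + t *\<^sub>R axis 3 1)) has_real_derivative 0) (at 0)"
      by simp
    with has_real_derivative_along_line[OF su, of p "axis 3 1" 0] show ?thesis
      using DERIV_unique by fastforce
  qed
  then have v0: "v = (\<lambda>p. 0)"
    using du \<open>l > 0\<close> by auto
  then show "partial 3 f2 p = 0"
    by (simp add: v_def fun_eq_iff)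
  have "partial 3 v p = 0"
    by (simp add: v0 frechet_derivative_const)
  then show "partial 3 f1 p = 0"
    using dv[of p] \<open>l > 0\<close> by (simp add: u_def)
qed

section \<open>Integration of the system\<close>

text \<open>A primitive for \<open>f3\<close>: its partials are \<open>f1\<close> in x and - l f2 in
  y, with the affine forms of \<open>f1\<close> and \<open>f2\<close> inserted.\<close>

lemma potential_has_derivative:
  assumes "l > 0"
  shows "((\<lambda>p :: real ^ 3. - (a * l / 2) * (p $ 2)\<^sup>2 - l * b * p $ 2 - a / (2 * l) * (p $ 1)\<^sup>2 + c * p $ 1)
    has_derivative (\<lambda>v. (- (a * l) * p $ 2 - l * b) * v $ 2 + (c - a / l * p $ 1) * v $ 1)) (at p)"
  using assms by (auto intro!: derivative_eq_intros has_derivative_vec_nth simp: field_simps)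

lemma collineation_system_solution:
  assumes "l > 0" and sm: "smooth f1" "smooth f2" "smooth f3"
    and sys: "collineation_system l f1 f2 f3"
  shows "\<exists>c1 c2 c3 c4. \<forall>p. f1 p = - (c1 / l) * p $ 1 + c3 \<and> f2 p = c1 * p $ 2 + c2 \<and>
    f3 p = - (c1 * l / 2) * (p $ 2)\<^sup>2 - l * c2 * p $ 2 - c1 / (2 * l) * (p $ 1)\<^sup>2 + c3 * p $ 1 + c4"
proof -
  note z = collineation_system_vertical_derivatives[OF assms]
  have eq: "partial 2 f1 p = 0" "partial 1 f2 p = 0" "partial 3 f3 p = 0"
    "partial 2 f2 p = - l * partial 1 f1 p" "partial 2 f3 p = - l * f2 p" "partial 1 f3 p = f1 p" for p
    using sys \<open>l > 0\<close> unfolding collineation_system_def z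
    by (simp_all add: algebra_simps eq_neg_iff_add_eq_0)
  have "f1 (p + t *\<^sub>R axis 2 1) = f1 p" "f1 (p + t *\<^sub>R axis 3 1) = f1 p"
    "f2 (p + t *\<^sub>R axis 1 1) = f2 p" for p t
    by (rule constant_along_line; simp only: sm eq z)+
  then have lines: "partial 1 f1 (p + t *\<^sub>R axis 2 1) = partial 1 f1 p"
    "partial 1 f1 (p + t *\<^sub>R axis 3 1) = partial 1 f1 p"
    "partial 2 f2 (p + t *\<^sub>R axis 1 1) = partial 2 f2 p" for p t
    by (intro frechet_derivative_translate sm; blast)+
  \<comment> \<open>The function \<open>partial 1 f1\<close> depends on x alone. By the fourth
    equation it is proportional to \<open>partial 2 f2\<close>, which does not depend on x, so both
    are constant.\<close>
  have c1: "partial 1 f1 p = partial 1 f1 0" for p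
  proof -
    have step1: "partial 1 f1 q = partial 1 f1 0" if "q $ 2 = 0" "q $ 3 = 0" for q
    proof -
      have "q = 0 + q $ 1 *\<^sub>R axis 1 1"
        using that by (simp add: vec_eq_iff forall_3 axis_component)
      then have "partial 2 f2 q = partial 2 f2 0"
        using lines(3)[of 0 "q $ 1"] by simp
      then show ?thesis
        using \<open>l > 0\<close> by (simp add: eq(4))
    qed
    have "p = p $ 1 *\<^sub>R axis 1 1 + p $ 2 *\<^sub>R axis 2 1 + p $ 3 *\<^sub>R axis 3 1"
      by (simp add: vec_eq_iff forall_3 axis_component)
    then have "partial 1 f1 p = partial 1 f1 (p $ 1 *\<^sub>R axis 1 1)"
      using lines(1,2) by metis
    also have "\<dots> = partial 1 f1 0"
      by (rule step1) (simp_all add: axis_component)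
    finally show ?thesis .
  qed
  \<comment> \<open>The constant is normalized as the y-slope of \<open>f2\<close>; the slope of
    \<open>f1\<close> in x is then - c / l.\<close>
  define c where "c = - l * partial 1 f1 0"
  have c: "partial 1 f1 p = - (c / l)" "partial 2 f2 p = c" for p
    using \<open>l > 0\<close> by (simp_all add: eq(4) c1[of p] c_def)
  have "frechet_derivative f1 (at p) v = - (c / l) * v $ 1" for p v
    using frechet_derivative_partials[OF sm(1), of p v] by (simp add: c eq(1) z)
  from eq_plus_const_if_derivative_eq[OF sm(1)
      has_derivative_mult_right[OF has_derivative_vec_nth] this]
  obtain c3 where c3: "\<And>p. f1 p = - (c / l) * p $ 1 + c3"
    by blast
  have "frechet_derivative f2 (at p) v = c * v $ 2" for p v
    using frechet_derivative_partials[OF sm(2), of p v] by (simp add: c eq(2) z)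
  from eq_plus_const_if_derivative_eq[OF sm(2)
      has_derivative_mult_right[OF has_derivative_vec_nth] this]
  obtain c2 where c2: "\<And>p. f2 p = c * p $ 2 + c2"
    by blast
  have "frechet_derivative f3 (at p) v =
      (- (c * l) * p $ 2 - l * c2) * v $ 2 + (c3 - c / l * p $ 1) * v $ 1" for p v
    using frechet_derivative_partials[OF sm(3), of p v]
    by (simp add: eq(3,5,6) c2 c3 algebra_simps)
  from eq_plus_const_if_derivative_eq[OF sm(3) potential_has_derivative[OF assms(1)] this]
  obtain c4 where "\<And>p. f3 p =
      (- (c * l / 2) * (p $ 2)\<^sup>2 - l * c2 * p $ 2 - c / (2 * l) * (p $ 1)\<^sup>2 + c3 * p $ 1) + c4"
    by blast
  with c2 c3 show ?thesis
    by blast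
qed

lemma collineation_system_if_solution:
  assumes "l > 0"
    and f1: "\<And>p. f1 p = - (c1 / l) * p $ 1 + c3"
    and f2: "\<And>p. f2 p = c1 * p $ 2 + c2"
    and f3: "\<And>p. f3 p =
      - (c1 * l / 2) * (p $ 2)\<^sup>2 - l * c2 * p $ 2 - c1 / (2 * l) * (p $ 1)\<^sup>2 + c3 * p $ 1 + c4"
  shows "collineation_system l f1 f2 f3"
proof -
  have "(f1 has_derivative (\<lambda>v. - (c1 / l) * v $ 1 + 0)) (at p)" for p
    unfolding f1[abs_def]
    by (intro has_derivative_add has_derivative_const has_derivative_mult_right has_derivative_vec_nth)
  note e = frechet_derivative_at[OF this]
  have d1: "frechet_derivative f1 (at p) v = - (c1 / l) * v $ 1" for p v
    using e[of p, THEN fun_cong, of v] by simp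
  have "(f2 has_derivative (\<lambda>v. c1 * v $ 2 + 0)) (at p)" for p
    unfolding f2[abs_def]
    by (intro has_derivative_add has_derivative_const has_derivative_mult_right has_derivative_vec_nth)
  note e = frechet_derivative_at[OF this]
  have d2: "frechet_derivative f2 (at p) v = c1 * v $ 2" for p v
    using e[of p, THEN fun_cong, of v] by simp
  have "(f3 has_derivative (\<lambda>v. (- (c1 * l) * p $ 2 - l * c2) * v $ 2 + (c3 - c1 / l * p $ 1) * v $ 1 + 0))
      (at p)" for p
    unfolding f3[abs_def] by (intro has_derivative_add has_derivative_const potential_has_derivative[OF assms(1)])
  note e = frechet_derivative_at[OF this]
  have d3: "frechet_derivative f3 (at p) v =
      (- (c1 * l) * p $ 2 - l * c2) * v $ 2 + (c3 - c1 / l * p $ 1) * v $ 1" for p v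
    using e[of p, THEN fun_cong, of v] by simp
  show "collineation_system l f1 f2 f3"
    using \<open>l > 0\<close>
    by (simp add: collineation_system_def d1 d2 d3 f1 f2 axis_component field_simps)
qed

theorem mainTheorem10:
  fixes l :: real
    and f1 f2 f3 :: "real ^ 3 \<Rightarrow> real"
    and X :: "real ^ 3 \<Rightarrow> real ^ 3"
    and D :: "(real ^ 3) connection"
  assumes "l > 0"
    and "levi_civita_connection (heis_metric l) D"
    and "smooth f1" and "smooth f2" and "smooth f3"
    and "X = (\<lambda>p. f1 p *\<^sub>R heis_e1 p + f2 p *\<^sub>R heis_e2 l p + f3 p *\<^sub>R heis_e3 p)"
  shows "(curvature_collineation D X \<longleftrightarrow> ricci_collineation (heis_metric l) D (heis_frame l) X) \<and>
    (ricci_collineation (heis_metric l) D (heis_frame l) X \<longleftrightarrow>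
      (\<exists>c1 c2 c3 c4 :: real. \<forall>x y z :: real.
         f1 (vector [x, y, z]) = - (c1 / l) * x + c3 \<and>
         f2 (vector [x, y, z]) = c1 * y + c2 \<and>
         f3 (vector [x, y, z]) =
           - (c1 * l / 2) * y\<^sup>2 - l * c2 * y - c1 / (2 * l) * x\<^sup>2 + c3 * x + c4))"
proof -
  note l = assms(1) and LC = assms(2) and f = assms(3-5) and X = assms(6)
  have sX: "smooth X"
    unfolding X by (intro smooth_add smooth_scaleR f smooth_heis_frame)
  let ?A = "bracket_twist l X"
  let ?f3 = "\<lambda>c1 c2 c3 c4 x y.
    - (c1 * l / 2) * y\<^sup>2 - l * c2 * y - c1 / (2 * l) * x\<^sup>2 + c3 * x + c4"
  have ricci: "ricci_collineation (heis_metric l) D (heis_frame l) X \<longleftrightarrow> collineation_system l f1 f2 f3"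
    using ricci_collineation_iff[OF l LC sX] skew_bracket_twist_iff[OF l f X] by simp
  have "collineation_system l f1 f2 f3 \<longleftrightarrow> (\<exists>c1 c2 c3 c4. \<forall>p.
      f1 p = - (c1 / l) * p $ 1 + c3 \<and> f2 p = c1 * p $ 2 + c2 \<and> f3 p = ?f3 c1 c2 c3 c4 (p $ 1) (p $ 2))"
    using collineation_system_solution[OF l f] collineation_system_if_solution[OF l] by blast
  also have "\<dots> \<longleftrightarrow> (\<exists>c1 c2 c3 c4. \<forall>x y z. f1 (vector [x, y, z]) = - (c1 / l) * x + c3 \<and>
      f2 (vector [x, y, z]) = c1 * y + c2 \<and> f3 (vector [x, y, z]) = ?f3 c1 c2 c3 c4 x y)"
  proof -
    \<comment> \<open>Every point is \<open>vector [x, y, z]\<close>, which allows passage from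
      points to coordinate triples.\<close>
    have "(\<forall>p. P p) \<longleftrightarrow> (\<forall>x y z. P (vector [x, y, z] :: real ^ 3))" for P
      using forall_vector_3 by blast
    then show ?thesis
      by simp
  qed
  finally have solution: "collineation_system l f1 f2 f3 \<longleftrightarrow> \<dots>" .
  have "curvature_collineation D X \<longleftrightarrow> ricci_collineation (heis_metric l) D (heis_frame l) X"
  proof
    assume "curvature_collineation D X"
    then have "skew_for_ricci (?A p)" for p
      using curvature_collineation_iff[OF l LC sX] linear_bracket_twist[OF sX] l
      by (intro skew_for_ricci_if_curvature_invariant) auto
    then show "ricci_collineation (heis_metric l) D (heis_frame l) X"
      using ricci_collineation_iff[OF l LC sX] by blast
  next
    assume "ricci_collineation (heis_metric l) D (heis_frame l) X"
    then have sys: "collineation_system l f1 f2 f3" and skew: "skew_for_ricci (?A p)" for p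
      using ricci ricci_collineation_iff[OF l LC sX] by blast+
    \<comment> \<open>The components of this vector are the negated z-derivatives of
      \<open>f1\<close>, \<open>f2\<close> and \<open>f3\<close>. The first two vanish by the
      oscillator argument, the third by skewness.\<close>
    have "?A p (axis 3 1) = 0" for p
      using skew[of p] collineation_system_vertical_derivatives[OF l f sys]
      by (simp add: vec_eq_iff forall_3 skew_for_ricci_def bracket_twist_nth[OF l f X] frame_axis)
    then show "curvature_collineation D X"
      unfolding curvature_collineation_iff[OF l LC sX]
      using curvature_invariant_if_rotation[OF linear_bracket_twist[OF sX] skew] by blast
  qed
  with ricci solution show ?thesis
    by blast
qed

end
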